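(* Let $\{\mathbb{A},\mathbb{B},c\}$ be a two-person zero-sum game such that: (a1) for each $b\in\mathbb{B}$ the function $a\mapsto c(a,b)$ is lower semi-continuous on $\mathbb{A}$; (a2) there exists $b_0\in\mathbb{B}$ such that $a\mapsto c(a,b_0)$ is inf-compact on $\mathbb{A}$; (b1) for each $a\in\mathbb{A}$ the function $b\mapsto c(a,b)$ is upper semi-continuous on $\mathbb{B}$; (b2) there exists $a_0\in\mathbb{A}$ such that $b\mapsto c(a_0,b)$ is sup-compact on $\mathbb{B}$; and such that $\hat c^{\sharp}(\pi^{\mathbb A})>v^{\sharp}$ for all $\pi^{\mathbb A}\in\mathbb{P}^U(\mathbb{A})$ and $\hat c^{\flat}(\pi^{\mathbb B})<v^{\flat}$ for all $\pi^{\mathbb B}\in\mathbb{P}^U(\mathbb{B})$. Then: (i) the game has a value $v\in\mathbb{R}$ and a solution $(\pi^{\mathbb A},\pi^{\mathbb B})\in\mathbb{P}^{\sharp}_{v}(\mathbb{A})\times\mathbb{P}^{\flat}_{v}(\mathbb{B})$; (ii) the sets $\mathbb{P}^{\sharp}_{v}(\mathbb{A})$ and $\mathbb{P}^{\flat}_{v}(\mathbb{B})$ are nonempty convex compact subsets of $\mathbb{P}(\mathbb{A})$ and $\mathbb{P}(\mathbb{B})$ respectively; moreover, $\mathbb{P}^{\sharp}_{v}(\mathbb{A})\subset\mathbb{P}^S(\mathbb{A})$ and $\mathbb{P}^{\flat}_{v}(\mathbb{B})\subset\mathbb{P}^S(\mathbb{B})$; (iii) a pair $(\pi^{\mathbb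 A},\pi^{\mathbb B})\in\mathbb{P}^S(\mathbb{A})\times\mathbb{P}^S(\mathbb{B})$ is a solution of the game if and only if $\pi^{\mathbb A}\in\mathbb{P}^{\sharp}_{v}(\mathbb{A})$ and $\pi^{\mathbb B}\in\mathbb{P}^{\flat}_{v}(\mathbb{B})$.
   Context: For a metric space $S$, $\mathbb{P}(S)$ is the set of Borel probability measures on $S$ with the topology of weak convergence. A function $f:S\to\mathbb{R}\cup\{\pm\infty\}$ is inf-compact on $S$ if $\{s\in S: f(s)\le\lambda\}$ is compact for every $\lambda\in\mathbb{R}$, and sup-compact if $-f$ is inf-compact. A two-person zero-sum game $\{\mathbb{A},\mathbb{B},c\}$ consists of (i) a nonempty Borel subset $\mathbb{A}$ of a Polish space; (ii) a nonempty Borel subset $\mathbb{B}$ of a Polish space; (iii) a Borel measurable payoff $c:\mathbb{A}\times\mathbb{B}\to\mathbb{R}$ (paid by Player I to Player II); such that (iv) for each $b\in\mathbb{B}$ the function $a\mapsto c(a,b)$ is bounded below on $\mathbb{A}$, and (v) for each $a\in\mathbb{A}$ the function $b\mapsto c(a,b)$ is bounded above on $\mathbb{B}$. Strategies of Players I and II are elements of $\mathbb{P}(\mathbb{A})$ and $\mathbb{P}(\mathbb{B})$; a point $a$ (or $b$) is identified with the Dirac measure at it. Let $c^+=\max\{c,0\}$, $c^-=\min\{c,0\}$ (so $c^-\le 0$), $\hat c^{\oplus}(\pi^{\mathbb A},\pi^{\mathbb B})=\int_{\mathbb A}\int_{\mathbb B}c^+(a,b)\,\pi^{\mathbb B}(db)\,\pi^{\mathbb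 A}(da)$ and $\hat c^{\ominus}(\pi^{\mathbb A},\pi^{\mathbb B})=\int_{\mathbb A}\int_{\mathbb B}c^-(a,b)\,\pi^{\mathbb B}(db)\,\pi^{\mathbb A}(da)$. The expected payoff $\hat c(\pi^{\mathbb A},\pi^{\mathbb B})=\hat c^{\oplus}(\pi^{\mathbb A},\pi^{\mathbb B})+\hat c^{\ominus}(\pi^{\mathbb A},\pi^{\mathbb B})$ is well-defined if $\hat c^{\oplus}(\pi^{\mathbb A},\pi^{\mathbb B})<+\infty$ or $\hat c^{\ominus}(\pi^{\mathbb A},\pi^{\mathbb B})>-\infty$, and undefined otherwise. By (iv),(v) it is well-defined whenever one of the strategies is a Dirac measure. $\mathbb{P}^S(\mathbb{A})$ (sensible strategies) is the set of $\pi^{\mathbb A}\in\mathbb{P}(\mathbb{A})$ such that $\hat c(\pi^{\mathbb A},\pi^{\mathbb B})$ is well-defined for every $\pi^{\mathbb B}\in\mathbb{P}(\mathbb{B})$, and $\mathbb{P}^U(\mathbb{A})=\mathbb{P}(\mathbb{A})\setminus\mathbb{P}^S(\mathbb{A})$; $\mathbb{P}^S(\mathbb{B})$ and $\mathbb{P}^U(\mathbb{B})$ are defined symmetrically. $\hat c^{\flat}(\pi^{\mathbb B})=\inf_{a\in\mathbb{A}}\hat c(a,\pi^{\mathbb B})$, $\hat c^{\sharp}(\pi^{\mathbb A})=\sup_{b\in\mathbb{B}}\hat c(\pi^{\mathbb A},b)$; $v^{\flat}=\sup_{\pi^{\mathbb B}\in\mathbb{P}^S(\mathbb{B})}\hat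 c^{\flat}(\pi^{\mathbb B})$, $v^{\sharp}=\inf_{\pi^{\mathbb A}\in\mathbb{P}^S(\mathbb{A})}\hat c^{\sharp}(\pi^{\mathbb A})$. The game has a value $v$ if $v^{\flat}=v^{\sharp}$, and then $v$ is this common quantity. For an extended real $\alpha$, $\mathbb{P}^{\sharp}_{\alpha}(\mathbb{A})=\{\pi^{\mathbb A}\in\mathbb{P}(\mathbb{A}):\hat c^{\sharp}(\pi^{\mathbb A})\le\alpha\}$ and $\mathbb{P}^{\flat}_{\alpha}(\mathbb{B})=\{\pi^{\mathbb B}\in\mathbb{P}(\mathbb{B}):\hat c^{\flat}(\pi^{\mathbb B})\ge\alpha\}$. A solution of the game is a pair $(\pi^{\mathbb A},\pi^{\mathbb B})\in\mathbb{P}^S(\mathbb{A})\times\mathbb{P}^S(\mathbb{B})$ with $\hat c(\pi^{\mathbb A},\pi^{\mathbb B}_* )\le\hat c(\pi^{\mathbb A},\pi^{\mathbb B})\le\hat c(\pi^{\mathbb A}_*,\pi^{\mathbb B})$ for all $\pi^{\mathbb A}_*\in\mathbb{P}(\mathbb{A})$ and $\pi^{\mathbb B}_*\in\mathbb{P}(\mathbb{B})$. *)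

theory Defs
  imports "HOL-Probability.Probability"
begin

section \<open>Semicontinuity and inf-compactness relative to a set\<close>

definition lsc_on :: "'a::topological_space set \<Rightarrow> ('a \<Rightarrow> ereal) \<Rightarrow> bool" where
  "lsc_on S f \<longleftrightarrow> (\<forall>x\<in>S. f x \<le> Liminf (at x within S) f)"

definition usc_on :: "'a::topological_space set \<Rightarrow> ('a \<Rightarrow> ereal) \<Rightarrow> bool" where
  "usc_on S f \<longleftrightarrow> (\<forall>x\<in>S. Limsup (at x within S) f \<le> f x)"

definition inf_compact_on :: "'a::topological_space set \<Rightarrow> ('a \<Rightarrow> ereal) \<Rightarrow> bool" where
  "inf_compact_on S f \<longleftrightarrow> (\<forall>l::real. compact {s\<in>S. f s \<le> ereal l})"

definition sup_compact_on :: "'a::topological_space set \<Rightarrow> ('a \<Rightarrow> ereal) \<Rightarrow> bool" where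
  "sup_compact_on S f \<longleftrightarrow> inf_compact_on S (\<lambda>s. - f s)"

section \<open>Spaces of probability measures\<close>

text \<open>The measures in \<open>borel_probs S\<close> live on the subspace \<open>S\<close>: their space is \<open>S\<close>, not the
  whole type.\<close>

definition borel_probs :: "'a::topological_space set \<Rightarrow> 'a measure set" where
  "borel_probs S = space (prob_algebra (restrict_space borel S))"

lemma borel_probs_iff:
  "M \<in> borel_probs S \<longleftrightarrow> sets M = sets (restrict_space borel S) \<and> prob_space M"
  by (auto simp: borel_probs_def space_prob_algebra)

definition dirac_on :: "'a::topological_space set \<Rightarrow> 'a \<Rightarrow> 'a measure" where
  "dirac_on S s = return (restrict_space borel S) s"

text \<open>The topology of weak convergence is the coarsest one making all maps
  \<open>M \<mapsto> \<integral>f dM\<close>, with \<open>f\<close> bounded and continuous on \<open>S\<close>, continuous.\<close>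

definition weak_topology :: "'a::topological_space set \<Rightarrow> 'a measure topology" where
  "weak_topology S = topology_generated_by
     {{M \<in> borel_probs S. (\<integral>s. f s \<partial>M) \<in> U} | (f :: 'a \<Rightarrow> real) U.
        continuous_on S f \<and> bounded (f ` S) \<and> open U}"

lemma topspace_weak_topology: "topspace (weak_topology S) = borel_probs S"
proof -
  have "borel_probs S = {M \<in> borel_probs S. (\<integral>s. (\<lambda>_. 0) s \<partial>M) \<in> (UNIV :: real set)}"
    by simp
  moreover have "continuous_on S (\<lambda>_. 0 :: real)" "bounded ((\<lambda>_. 0 :: real) ` S)"
    by (auto simp: bounded_iff)
  ultimately show ?thesis
    unfolding weak_topology_def topology_generated_by_topspace by blast
qed

text \<open>\<open>mixture t M N\<close> is \<open>t M + (1 - t) N\<close>; it is meaningful for measures with the same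
  measurable sets.\<close>

definition mixture :: "real \<Rightarrow> 'a measure \<Rightarrow> 'a measure \<Rightarrow> 'a measure" where
  "mixture t M N = measure_of (space M) (sets M)
     (\<lambda>E. ennreal t * emeasure M E + ennreal (1 - t) * emeasure N E)"

lemma sets_mixture [simp]: "sets (mixture t M N) = sets M"
  by (simp add: mixture_def)

lemma emeasure_mixture:
  assumes "sets N = sets M" "E \<in> sets M"
  shows "emeasure (mixture t M N) E = ennreal t * emeasure M E + ennreal (1 - t) * emeasure N E"
  unfolding mixture_def
proof (rule emeasure_measure_of_sigma)
  show "sigma_algebra (space M) (sets M)"
    by (rule sets.sigma_algebra_axioms)
  show "positive (sets M) (\<lambda>E. ennreal t * emeasure M E + ennreal (1 - t) * emeasure N E)"
    by (simp add: positive_def)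
  show "countably_additive (sets M)
          (\<lambda>E. ennreal t * emeasure M E + ennreal (1 - t) * emeasure N E)"
    unfolding countably_additive_def
  proof (intro allI impI)
    fix F :: "nat \<Rightarrow> 'a set"
    assume F: "range F \<subseteq> sets M" "disjoint_family F"
    then show "(\<Sum>i. ennreal t * emeasure M (F i) + ennreal (1 - t) * emeasure N (F i)) =
        ennreal t * emeasure M (\<Union> (range F)) + ennreal (1 - t) * emeasure N (\<Union> (range F))"
      using assms(1)
      by (simp add: suminf_add [symmetric] ennreal_suminf_cmult suminf_emeasure)
  qed
qed (use assms in auto)

definition convex_measures :: "'a measure set \<Rightarrow> bool" where
  "convex_measures K \<longleftrightarrow> (\<forall>M\<in>K. \<forall>N\<in>K. \<forall>t\<in>{0..1}. mixture t M N \<in> K)"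

section \<open>Two-person zero-sum games\<close>

definition zero_sum_game ::
    "'a::polish_space set \<Rightarrow> 'b::polish_space set \<Rightarrow> ('a \<times> 'b \<Rightarrow> real) \<Rightarrow> bool" where
  "zero_sum_game A B c \<longleftrightarrow>
     A \<noteq> {} \<and> A \<in> sets borel \<and>
     B \<noteq> {} \<and> B \<in> sets borel \<and>
     c \<in> borel_measurable (restrict_space borel (A \<times> B)) \<and>
     (\<forall>b\<in>B. bdd_below ((\<lambda>a. c (a, b)) ` A)) \<and>
     (\<forall>a\<in>A. bdd_above ((\<lambda>b. c (a, b)) ` B))"

definition payoff_pos :: "('a \<times> 'b \<Rightarrow> real) \<Rightarrow> 'a measure \<Rightarrow> 'b measure \<Rightarrow> ereal" where
  "payoff_pos c \<pi>A \<pi>B = enn2ereal (\<integral>\<^sup>+a. (\<integral>\<^sup>+b. ennreal (max (c (a, b)) 0) \<partial>\<pi>B) \<partial>\<pi>A)"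

definition payoff_neg :: "('a \<times> 'b \<Rightarrow> real) \<Rightarrow> 'a measure \<Rightarrow> 'b measure \<Rightarrow> ereal" where
  "payoff_neg c \<pi>A \<pi>B = - enn2ereal (\<integral>\<^sup>+a. (\<integral>\<^sup>+b. ennreal (- min (c (a, b)) 0) \<partial>\<pi>B) \<partial>\<pi>A)"

definition payoff_defined :: "('a \<times> 'b \<Rightarrow> real) \<Rightarrow> 'a measure \<Rightarrow> 'b measure \<Rightarrow> bool" where
  "payoff_defined c \<pi>A \<pi>B \<longleftrightarrow> payoff_pos c \<pi>A \<pi>B < \<infinity> \<or> payoff_neg c \<pi>A \<pi>B > - \<infinity>"

text \<open>The value of \<open>payoff\<close> is meaningful only where \<open>payoff_defined\<close> holds (elsewhere it is the
  junk value \<open>\<infinity> + - \<infinity>\<close> of \<^typ>\<open>ereal\<close>). Below it is used only when one of the two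
  strategies is a Dirac measure or sensible.\<close>

definition payoff :: "('a \<times> 'b \<Rightarrow> real) \<Rightarrow> 'a measure \<Rightarrow> 'b measure \<Rightarrow> ereal" where
  "payoff c \<pi>A \<pi>B = payoff_pos c \<pi>A \<pi>B + payoff_neg c \<pi>A \<pi>B"

definition sensible_I ::
    "'a::polish_space set \<Rightarrow> 'b::polish_space set \<Rightarrow> ('a \<times> 'b \<Rightarrow> real) \<Rightarrow> 'a measure set" where
  "sensible_I A B c = {\<pi>A \<in> borel_probs A. \<forall>\<pi>B\<in>borel_probs B. payoff_defined c \<pi>A \<pi>B}"

definition sensible_II ::
    "'a::polish_space set \<Rightarrow> 'b::polish_space set \<Rightarrow> ('a \<times> 'b \<Rightarrow> real) \<Rightarrow> 'b measure set" where
  "sensible_II A B c = {\<pi>B \<in> borel_probs B. \<forall>\<pi>A\<in>borel_probs A. payoff_defined c \<pi>A \<pi>B}"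

definition unsensible_I ::
    "'a::polish_space set \<Rightarrow> 'b::polish_space set \<Rightarrow> ('a \<times> 'b \<Rightarrow> real) \<Rightarrow> 'a measure set" where
  "unsensible_I A B c = borel_probs A - sensible_I A B c"

definition unsensible_II ::
    "'a::polish_space set \<Rightarrow> 'b::polish_space set \<Rightarrow> ('a \<times> 'b \<Rightarrow> real) \<Rightarrow> 'b measure set" where
  "unsensible_II A B c = borel_probs B - sensible_II A B c"

definition payoff_sharp ::
    "'b::polish_space set \<Rightarrow> ('a::polish_space \<times> 'b \<Rightarrow> real) \<Rightarrow> 'a measure \<Rightarrow> ereal" where
  "payoff_sharp B c \<pi>A = (SUP b\<in>B. payoff c \<pi>A (dirac_on B b))"

definition payoff_flat ::
    "'a::polish_space set \<Rightarrow> ('a \<times> 'b::polish_space \<Rightarrow> real) \<Rightarrow> 'b measure \<Rightarrow> ereal" where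
  "payoff_flat A c \<pi>B = (INF a\<in>A. payoff c (dirac_on A a) \<pi>B)"

definition value_sharp ::
    "'a::polish_space set \<Rightarrow> 'b::polish_space set \<Rightarrow> ('a \<times> 'b \<Rightarrow> real) \<Rightarrow> ereal" where
  "value_sharp A B c = (INF \<pi>A\<in>sensible_I A B c. payoff_sharp B c \<pi>A)"

definition value_flat ::
    "'a::polish_space set \<Rightarrow> 'b::polish_space set \<Rightarrow> ('a \<times> 'b \<Rightarrow> real) \<Rightarrow> ereal" where
  "value_flat A B c = (SUP \<pi>B\<in>sensible_II A B c. payoff_flat A c \<pi>B)"

definition has_value ::
    "'a::polish_space set \<Rightarrow> 'b::polish_space set \<Rightarrow> ('a \<times> 'b \<Rightarrow> real) \<Rightarrow> ereal \<Rightarrow> bool" where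
  "has_value A B c v \<longleftrightarrow> value_flat A B c = v \<and> value_sharp A B c = v"

definition sublevel_sharp ::
    "'a::polish_space set \<Rightarrow> 'b::polish_space set \<Rightarrow> ('a \<times> 'b \<Rightarrow> real) \<Rightarrow> ereal \<Rightarrow> 'a measure set" where
  "sublevel_sharp A B c \<alpha> = {\<pi>A \<in> borel_probs A. payoff_sharp B c \<pi>A \<le> \<alpha>}"

definition superlevel_flat ::
    "'a::polish_space set \<Rightarrow> 'b::polish_space set \<Rightarrow> ('a \<times> 'b \<Rightarrow> real) \<Rightarrow> ereal \<Rightarrow> 'b measure set" where
  "superlevel_flat A B c \<alpha> = {\<pi>B \<in> borel_probs B. payoff_flat A c \<pi>B \<ge> \<alpha>}"

definition is_solution ::
    "'a::polish_space set \<Rightarrow> 'b::polish_space set \<Rightarrow> ('a \<times> 'b \<Rightarrow> real) \<Rightarrow>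
     'a measure \<Rightarrow> 'b measure \<Rightarrow> bool" where
  "is_solution A B c \<pi>A \<pi>B \<longleftrightarrow>
     \<pi>A \<in> sensible_I A B c \<and> \<pi>B \<in> sensible_II A B c \<and>
     (\<forall>\<pi>A'\<in>borel_probs A. \<forall>\<pi>B'\<in>borel_probs B.
        payoff c \<pi>A \<pi>B' \<le> payoff c \<pi>A \<pi>B \<and> payoff c \<pi>A \<pi>B \<le> payoff c \<pi>A' \<pi>B)"

end

theory Submission
  imports Defs
begin

text \<open>The proof needs compactness for one player at a time and a minimax principle for finitely many
pure strategies only.

Write \<open>\<integral>c(\<cdot>, b) dM\<close> for the payoff of a mixed strategy \<open>M\<close> of Player I against the point \<open>b\<close>.
Since \<open>c(\<cdot>, b)\<close> is lower semicontinuous and bounded below, it is an increasing limit of bounded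
continuous functions; hence a bound \<open>\<integral>c(\<cdot>, b) dM \<le> r\<close> is a family of bounds on integrals of
bounded continuous functions, and the \<open>cut\<close> of all \<open>M\<close> satisfying it is weakly closed. For the point
\<open>b0\<close> with \<open>c(\<cdot>, b0)\<close> inf-compact the cut is even weakly compact
(\<open>compactin_ext_integral_sublevel\<close>): the sublevel sets of \<open>c(\<cdot>, b0)\<close> are compact sets that, by
Markov's inequality, carry almost all the mass uniformly over the cut. That this suffices is the
direct half of Prokhorov's theorem. It is obtained from Tychonoff's theorem: measures are regarded as
functionals on bounded continuous functions, the functionals that satisfy the linear relations and
inequalities valid on the cut form a closed subset of a compact product, and by Daniell's theorem
(\<open>representing_measure\<close>) each of them is integration against a measure in the cut.

Now let \<open>r\<close> be such that no mixed strategy of Player I guarantees a payoff of at most \<open>r\<close>, that is,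
all cuts at level \<open>r\<close> have empty intersection. By compactness already finitely many cuts, at a level
\<open>r + \<epsilon>\<close> with \<open>\<epsilon> > 0\<close>, have empty intersection (\<open>finitely_many_cuts\<close>). A separation argument
(\<open>convexlike_alternative\<close>) then yields a finitely supported, hence sensible, strategy of Player II that
guarantees \<open>r + \<epsilon>\<close>. So \<open>value_flat > r\<close>. Contrapositively, with \<open>r = value_flat\<close>, some strategy of
Player I guarantees at most \<open>value_flat\<close> (\<open>sublevel_sharp_nonempty\<close>).

By Tonelli's theorem \<open>value_flat \<le> value_sharp\<close> (\<open>value_flat_le_sharp\<close>). A strategy guaranteeing at most
\<open>value_flat\<close> is therefore sensible, since unsensible ones are assumed to guarantee only more than
\<open>value_sharp\<close>; so the two values agree. The statements about Player II follow by applying the same results to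
the dual game with payoff \<open>-c\<close> and exchanged players. Optimal strategies on both sides form a solution,
and conversely, by sandwiching the payoff between the guaranteed values.\<close>

section \<open>Bounded continuous functions and lower semicontinuity\<close>

text \<open>The test functions of the weak topology over \<open>S\<close>.\<close>
definition bcont :: "'a::topological_space set \<Rightarrow> ('a \<Rightarrow> real) set" where
  "bcont S = {f. continuous_on S f \<and> bounded (f ` S)}"

lemma bcontI:
  assumes "continuous_on S f" "\<And>x. x \<in> S \<Longrightarrow> \<bar>f x\<bar> \<le> K"
  shows "f \<in> bcont S"
  using assms by (auto simp: bcont_def bounded_iff)

lemma bcontE:
  assumes "f \<in> bcont S"
  obtains K where "continuous_on S f" "0 \<le> K" "\<And>x. x \<in> S \<Longrightarrow> \<bar>f x\<bar> \<le> K"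
proof -
  obtain K where "\<forall>x\<in>S. \<bar>f x\<bar> \<le> K"
    using assms by (auto simp: bcont_def bounded_iff)
  then show thesis
    using assms by (intro that[of "max 0 K"]) (auto simp: bcont_def)
qed

lemma bcont_const [simp]: "(\<lambda>_. k) \<in> bcont S"
  by (rule bcontI[where K = "\<bar>k\<bar>"]) auto

lemma bcont_add:
  assumes "f \<in> bcont S" "g \<in> bcont S" shows "(\<lambda>x. f x + g x) \<in> bcont S"
proof -
  obtain K L where "continuous_on S f" "\<And>x. x \<in> S \<Longrightarrow> \<bar>f x\<bar> \<le> K"
      "continuous_on S g" "\<And>x. x \<in> S \<Longrightarrow> \<bar>g x\<bar> \<le> L"
    using assms by (metis bcontE)
  then show ?thesis
    by (intro bcontI[where K = "K + L"] continuous_intros) (auto intro: order_trans[OF abs_triangle_ineq] add_mono)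
qed

lemma bcont_cmult:
  assumes "f \<in> bcont S" shows "(\<lambda>x. k * f x) \<in> bcont S"
proof -
  obtain K where "continuous_on S f" "\<And>x. x \<in> S \<Longrightarrow> \<bar>f x\<bar> \<le> K"
    using assms by (metis bcontE)
  then show ?thesis
    by (intro bcontI[where K = "\<bar>k\<bar> * K"] continuous_intros) (auto simp: abs_mult intro: mult_left_mono)
qed

lemma bcont_diff:
  assumes "f \<in> bcont S" "g \<in> bcont S" shows "(\<lambda>x. f x - g x) \<in> bcont S"
  using bcont_add[OF assms(1) bcont_cmult[OF assms(2), of "-1"]] by simp

lemma bcont_max:
  assumes "f \<in> bcont S" "g \<in> bcont S" shows "(\<lambda>x. max (f x) (g x)) \<in> bcont S"
proof -
  obtain K L where *: "continuous_on S f" "\<And>x. x \<in> S \<Longrightarrow> \<bar>f x\<bar> \<le> K"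
      "continuous_on S g" "\<And>x. x \<in> S \<Longrightarrow> \<bar>g x\<bar> \<le> L"
    using assms by (metis bcontE)
  show ?thesis
  proof (rule bcontI[where K = "max K L"])
    show "continuous_on S (\<lambda>x. max (f x) (g x))"
      using * by (intro continuous_intros)
    show "\<bar>max (f x) (g x)\<bar> \<le> max K L" if "x \<in> S" for x
      using *(2)[OF that] *(4)[OF that] by linarith
  qed
qed

lemma bcont_min:
  assumes "f \<in> bcont S" "g \<in> bcont S" shows "(\<lambda>x. min (f x) (g x)) \<in> bcont S"
proof -
  have "(\<lambda>x. min (f x) (g x)) = (\<lambda>x. -1 * max (-1 * f x) (-1 * g x))"
    by (auto simp: fun_eq_iff)
  then show ?thesis
    using bcont_cmult[OF bcont_max[OF bcont_cmult[OF assms(1), of "-1"] bcont_cmult[OF assms(2), of "-1"]], of "-1"]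
    by simp
qed

lemma lsc_onD:
  assumes "lsc_on A (\<lambda>a. ereal (\<phi> a))" "a \<in> A" "r < \<phi> a"
  shows "\<exists>d>0. \<forall>y\<in>A. dist (y::'a::metric_space) a < d \<longrightarrow> r < \<phi> y"
proof -
  have "\<forall>\<^sub>F x in at a within A. ereal r < ereal (\<phi> x)"
    using assms unfolding lsc_on_def le_Liminf_iff by (metis ereal_less_eq(3) less_ereal.simps(1))
  then obtain d where d: "d > 0" "\<And>y. y \<in> A \<Longrightarrow> y \<noteq> a \<Longrightarrow> dist y a < d \<Longrightarrow> r < \<phi> y"
    unfolding eventually_at by auto
  with assms(3) show ?thesis by (metis)
qed

text \<open>The approximants are truncated Moreau--Yosida regularizations
\<open>inf\<^sub>y (\<phi> y + n \<cdot> dist a y)\<close>: they are \<open>n\<close>-Lipschitz as infima of such functions, and lower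
semicontinuity forces them up to \<open>\<phi>\<close>, because far from \<open>a\<close> the penalty \<open>n \<cdot> dist a y\<close> outweighs the lower
bound \<open>-m\<close>.\<close>
lemma lsc_on_approx_bcont:
  fixes \<phi> :: "'a::metric_space \<Rightarrow> real"
  assumes lsc: "lsc_on A (\<lambda>a. ereal (\<phi> a))" and m: "m \<ge> 0" "\<And>a. a \<in> A \<Longrightarrow> - m \<le> \<phi> a"
  obtains F :: "nat \<Rightarrow> 'a \<Rightarrow> real" where
    "\<And>n. F n \<in> bcont A"
    "\<And>n a. a \<in> A \<Longrightarrow> - m \<le> F n a" "\<And>n a. a \<in> A \<Longrightarrow> F n a \<le> \<phi> a"
    "\<And>a. a \<in> A \<Longrightarrow> incseq (\<lambda>n. F n a)"
    "\<And>a. a \<in> A \<Longrightarrow> (\<lambda>n. F n a) \<longlonglongrightarrow> \<phi> a"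
proof -
  define G where "G n a = (INF y\<in>A. \<phi> y + real n * dist a y)" for n :: nat and a
  have bdd: "bdd_below ((\<lambda>y. \<phi> y + real n * dist a y) ` A)" for n a
    using m(2) by (intro bdd_belowI2[of _ "- m"]) (smt (verit) of_nat_0_le_iff zero_le_dist mult_nonneg_nonneg)
  have G_le: "G n a \<le> \<phi> y + real n * dist a y" if "y \<in> A" for n a y
    unfolding G_def by (rule cINF_lower[OF bdd that])
  have G_ge: "u \<le> G n a" if "a \<in> A" "\<And>y. y \<in> A \<Longrightarrow> u \<le> \<phi> y + real n * dist a y" for n a u
    unfolding G_def using that by (intro cINF_greatest) auto
  have G_lip: "G n a \<le> G n b + real n * dist a b" if "a \<in> A" "b \<in> A" for n a b
  proof -
    have "G n a - real n * dist a b \<le> G n b"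
    proof (rule G_ge[OF that(2)])
      fix y assume "y \<in> A"
      have "real n * dist a y \<le> real n * dist a b + real n * dist b y"
        using dist_triangle[of a y b] by (metis mult_left_mono of_nat_0_le_iff distrib_left)
      then show "G n a - real n * dist a b \<le> \<phi> y + real n * dist b y"
        using G_le[OF \<open>y \<in> A\<close>, of n a] by linarith
    qed
    then show ?thesis by linarith
  qed
  have cont: "continuous_on A (G n)" for n
  proof (rule continuous_on_iff[THEN iffD2], intro ballI allI impI)
    fix a and e :: real assume "a \<in> A" "e > 0"
    show "\<exists>d>0. \<forall>b\<in>A. dist b a < d \<longrightarrow> dist (G n b) (G n a) < e"
    proof (intro exI[of _ "e / (real n + 1)"] conjI ballI impI)
      show "0 < e / (real n + 1)" using \<open>e > 0\<close> by auto
      fix b assume "b \<in> A" "dist b a < e / (real n + 1)"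
      then have "real n * dist b a \<le> (real n + 1) * dist b a" "(real n + 1) * dist b a < e"
        by (auto simp: field_simps)
      then show "dist (G n b) (G n a) < e"
        using G_lip[OF \<open>a \<in> A\<close> \<open>b \<in> A\<close>, of n] G_lip[OF \<open>b \<in> A\<close> \<open>a \<in> A\<close>, of n]
        by (auto simp: dist_real_def dist_commute)
    qed
  qed
  define F where "F n a = min (real n) (G n a)" for n a
  have G_lower: "- m \<le> G n a" if "a \<in> A" for n a
  proof (rule G_ge[OF that])
    fix y assume "y \<in> A"
    have "0 \<le> real n * dist a y" by simp
    then show "- m \<le> \<phi> y + real n * dist a y" using m(2)[OF \<open>y \<in> A\<close>] by linarith
  qed
  have G_mono: "G n a \<le> G k a" if "a \<in> A" "n \<le> k" for n k a
  proof (rule G_ge[OF \<open>a \<in> A\<close>])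
    fix y assume "y \<in> A"
    have "real n * dist a y \<le> real k * dist a y"
      using \<open>n \<le> k\<close> by (intro mult_right_mono) auto
    then show "G n a \<le> \<phi> y + real k * dist a y"
      using G_le[OF \<open>y \<in> A\<close>, of n a] by linarith
  qed
  show thesis
  proof (rule that[of F])
    show "F n \<in> bcont A" for n
      unfolding F_def
    proof (rule bcontI[where K = "real n + m"])
      show "continuous_on A (\<lambda>a. min (real n) (G n a))"
        using cont by (intro continuous_intros)
      show "\<bar>min (real n) (G n a)\<bar> \<le> real n + m" if "a \<in> A" for a
        using G_lower[OF that, of n] m(1) by linarith
    qed
    show "- m \<le> F n a" if "a \<in> A" for n a
      using G_lower[OF that, of n] m(1) unfolding F_def by linarith
    show F_le: "F n a \<le> \<phi> a" if "a \<in> A" for n a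
      using G_le[OF that, of n a] unfolding F_def by simp
    show inc: "incseq (\<lambda>n. F n a)" if "a \<in> A" for a
      using G_mono[OF that] unfolding F_def by (intro monoI min.mono) auto
    show "(\<lambda>n. F n a) \<longlonglongrightarrow> \<phi> a" if a: "a \<in> A" for a
    proof (rule increasing_tendsto)
      show "\<forall>\<^sub>F n in sequentially. F n a \<le> \<phi> a" using F_le[OF a] by simp
      fix r assume "r < \<phi> a"
      then obtain s where s: "r < s" "s < \<phi> a" using dense by blast
      obtain d where d: "d > 0" "\<And>y. y \<in> A \<Longrightarrow> dist y a < d \<Longrightarrow> s < \<phi> y"
        using lsc_onD[OF lsc a s(2)] by metis
      obtain N1 :: nat where N1: "r < real N1" using reals_Archimedean2 by blast
      obtain N2 :: nat where N2: "(s + m) / d < real N2" using reals_Archimedean2 by blast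
      show "\<forall>\<^sub>F n in sequentially. r < F n a"
        unfolding eventually_sequentially
      proof (intro exI[of _ "max N1 N2"] allI impI)
        fix n assume n: "max N1 N2 \<le> n"
        have "s \<le> G n a"
        proof (rule G_ge[OF a])
          fix y assume y: "y \<in> A"
          show "s \<le> \<phi> y + real n * dist a y"
          proof (cases "dist y a < d")
            case True
            have "0 \<le> real n * dist a y" by simp
            then show ?thesis using d(2)[OF y True] by linarith
          next
            case False
            have "(s + m) / d \<le> real n" using N2 n by linarith
            then have "s + m \<le> real n * d" using d(1) by (simp add: field_simps)
            also have "\<dots> \<le> real n * dist a y"
              using False by (intro mult_left_mono) (auto simp: dist_commute)
            finally show ?thesis using m(2)[OF y] by linarith
          qed
        qed
        then show "r < F n a" using s N1 n unfolding F_def by auto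
      qed
    qed
  qed
qed

section \<open>Extended integrals of functions bounded below\<close>

lemma borel_probs_space: "M \<in> borel_probs A \<Longrightarrow> space M = A"
  by (metis borel_probs_iff sets_eq_imp_space_eq space_restrict_space2 space_borel inf_top.right_neutral space_restrict_space)

lemma borel_probs_measurable:
  "M \<in> borel_probs A \<Longrightarrow> f \<in> measurable M N \<longleftrightarrow> f \<in> measurable (restrict_space borel A) N"
  by (simp add: borel_probs_iff cong: measurable_cong_sets)

lemma bcont_integrable:
  assumes "M \<in> borel_probs A" "f \<in> bcont A"
  shows "integrable M f"
proof -
  interpret prob_space M using assms(1) by (simp add: borel_probs_iff)
  obtain K where K: "continuous_on A f" "\<And>x. x \<in> A \<Longrightarrow> \<bar>f x\<bar> \<le> K"
    using assms(2) by (metis bcontE)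
  show ?thesis
  proof (rule integrable_const_bound[where B = K])
    show "AE x in M. norm (f x) \<le> K"
      using K(2) borel_probs_space[OF assms(1)] by (intro AE_I2) auto
    show "f \<in> borel_measurable M"
      using borel_measurable_continuous_on_restrict[OF K(1)] by (simp add: borel_probs_measurable[OF assms(1)])
  qed
qed

text \<open>For \<open>\<phi>\<close> bounded below and \<open>M\<close> finite the subtracted term is finite, so the value is the
usual integral with \<open>\<infinity>\<close> allowed.\<close>
definition ext_integral :: "'a measure \<Rightarrow> ('a \<Rightarrow> real) \<Rightarrow> ereal" where
  "ext_integral M \<phi> = enn2ereal (\<integral>\<^sup>+x. ennreal (\<phi> x) \<partial>M) - enn2ereal (\<integral>\<^sup>+x. ennreal (- \<phi> x) \<partial>M)"

text \<open>Shifting by \<open>m\<close> makes the integrand nonnegative; the condition \<open>0 \<le> \<alpha> + m\<close> keeps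
\<open>ennreal (\<alpha> + m)\<close> from collapsing to \<open>0\<close>.\<close>
lemma ext_integral_le_iff_nn:
  assumes "prob_space M" and [measurable]: "\<phi> \<in> borel_measurable M"
    and m: "m \<ge> 0" "\<And>a. a \<in> space M \<Longrightarrow> - m \<le> \<phi> a" and \<alpha>: "0 \<le> \<alpha> + m"
  shows "ext_integral M \<phi> \<le> ereal \<alpha> \<longleftrightarrow> (\<integral>\<^sup>+x. ennreal (\<phi> x + m) \<partial>M) \<le> ennreal (\<alpha> + m)"
proof -
  interpret prob_space M by fact
  define P where "P = (\<integral>\<^sup>+x. ennreal (\<phi> x) \<partial>M)"
  define N where "N = (\<integral>\<^sup>+x. ennreal (- \<phi> x) \<partial>M)"
  define X where "X = (\<integral>\<^sup>+x. ennreal (\<phi> x + m) \<partial>M)"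
  have "N \<le> (\<integral>\<^sup>+x. ennreal m \<partial>M)"
    unfolding N_def using m(2) by (intro nn_integral_mono ennreal_leI) (smt (verit))
  also have "\<dots> = ennreal m" by (simp add: emeasure_space_1)
  finally have N: "N \<le> ennreal m" .
  have "X + N = (\<integral>\<^sup>+x. ennreal (\<phi> x + m) + ennreal (- \<phi> x) \<partial>M)"
    unfolding X_def N_def by (subst nn_integral_add) auto
  also have "\<dots> = (\<integral>\<^sup>+x. ennreal (\<phi> x) + ennreal m \<partial>M)"
  proof (rule nn_integral_cong)
    fix x assume "x \<in> space M"
    then have "- m \<le> \<phi> x" by (rule m(2))
    then show "ennreal (\<phi> x + m) + ennreal (- \<phi> x) = ennreal (\<phi> x) + ennreal m"
      using m(1) by (cases "\<phi> x \<ge> 0") (auto simp: ennreal_neg ennreal_plus[symmetric] simp del: ennreal_plus)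
  qed
  also have "\<dots> = P + ennreal m"
    unfolding P_def by (subst nn_integral_add) (auto simp: emeasure_space_1)
  finally have eq: "X + N = P + ennreal m" .
  obtain n where n: "n \<ge> 0" "N = ennreal n" using N by (cases N) (auto simp: top_unique)
  have "enn2ereal P - enn2ereal N \<le> ereal \<alpha> \<longleftrightarrow> X \<le> ennreal (\<alpha> + m)"
  proof (cases P)
    case (real p)
    then obtain x where x: "x \<ge> 0" "X = ennreal x"
      using eq n by (cases X) (auto simp: ennreal_plus[symmetric] m(1) simp del: ennreal_plus)
    have "x + n = p + m"
      using eq x n real m(1) by (simp add: ennreal_plus[symmetric] del: ennreal_plus)
    then show ?thesis using x n real \<alpha> by (auto simp: ennreal_le_iff)
  next
    case top
    then have "X = top" using eq n by (cases X) (auto simp: ennreal_plus[symmetric] simp del: ennreal_plus)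
    then show ?thesis using top n by (auto simp: top_unique)
  qed
  then show ?thesis unfolding ext_integral_def P_def N_def X_def .
qed

text \<open>Monotone convergence along \<open>lsc_on_approx_bcont\<close> turns a bound on the integral of a lower
semicontinuous function into bounds that the weak topology sees.\<close>
lemma ext_integral_le_iff_bcont:
  fixes \<phi> :: "'a::metric_space \<Rightarrow> real"
  assumes M: "M \<in> borel_probs A" and lsc: "lsc_on A (\<lambda>a. ereal (\<phi> a))"
    and meas: "\<phi> \<in> borel_measurable (restrict_space borel A)"
    and bdd: "bdd_below (\<phi> ` A)"
  shows "ext_integral M \<phi> \<le> ereal \<alpha> \<longleftrightarrow>
    (\<forall>f\<in>bcont A. (\<forall>a\<in>A. f a \<le> \<phi> a) \<longrightarrow> (\<integral>a. f a \<partial>M) \<le> \<alpha>)"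
proof -
  interpret prob_space M using M by (simp add: borel_probs_iff)
  have sp: "space M = A" using M by (rule borel_probs_space)
  have [measurable]: "\<phi> \<in> borel_measurable M" using meas by (simp add: borel_probs_measurable[OF M])
  obtain m0 where m0: "\<And>a. a \<in> A \<Longrightarrow> m0 \<le> \<phi> a" using bdd by (auto simp: bdd_below_def)
  \<comment> \<open>The second summand makes \<open>\<alpha> + m\<close> nonnegative.\<close>
  define m where "m = \<bar>m0\<bar> + \<bar>\<alpha>\<bar>"
  have m: "m \<ge> 0" "0 \<le> \<alpha> + m" "\<And>a. a \<in> A \<Longrightarrow> - m \<le> \<phi> a"
    using m0 unfolding m_def by fastforce+
  have shift: "(\<integral>\<^sup>+x. ennreal (f x + m) \<partial>M) = ennreal ((\<integral>x. f x \<partial>M) + m)"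
    if "f \<in> bcont A" "\<And>a. a \<in> A \<Longrightarrow> - m \<le> f a" for f
  proof -
    have "integrable M f" using bcont_integrable[OF M that(1)] .
    then have "(\<integral>\<^sup>+x. ennreal (f x + m) \<partial>M) = ennreal (\<integral>x. f x + m \<partial>M)"
      using that(2) sp by (intro nn_integral_eq_integral) (auto intro!: AE_I2 simp: add_increasing, smt (verit))
    also have "(\<integral>x. f x + m \<partial>M) = (\<integral>x. f x \<partial>M) + m"
      using \<open>integrable M f\<close> by (subst Bochner_Integration.integral_add) (auto simp: prob_space)
    finally show ?thesis .
  qed
  have key: "ext_integral M \<phi> \<le> ereal \<alpha> \<longleftrightarrow> (\<integral>\<^sup>+x. ennreal (\<phi> x + m) \<partial>M) \<le> ennreal (\<alpha> + m)"
    using m sp by (intro ext_integral_le_iff_nn) (auto intro: prob_space_axioms)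
  show ?thesis
    unfolding key
  proof (intro iffI ballI impI)
    fix f assume le: "(\<integral>\<^sup>+x. ennreal (\<phi> x + m) \<partial>M) \<le> ennreal (\<alpha> + m)"
      and f: "f \<in> bcont A" "\<forall>a\<in>A. f a \<le> \<phi> a"
    \<comment> \<open>A minorant \<open>f\<close> may lie below \<open>-m\<close>, where the shift would be lost.\<close>
    have g: "(\<lambda>a. max (f a) (- m)) \<in> bcont A" by (intro bcont_max f bcont_const)
    have "ennreal ((\<integral>a. max (f a) (- m) \<partial>M) + m) = (\<integral>\<^sup>+x. ennreal (max (f x) (- m) + m) \<partial>M)"
      by (rule shift[OF g, symmetric]) auto
    also have "\<dots> \<le> (\<integral>\<^sup>+x. ennreal (\<phi> x + m) \<partial>M)"
      using f m sp by (intro nn_integral_mono ennreal_leI) auto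
    also note le
    finally have "(\<integral>a. max (f a) (- m) \<partial>M) \<le> \<alpha>" using m by (simp add: ennreal_le_iff)
    moreover have "(\<integral>a. f a \<partial>M) \<le> (\<integral>a. max (f a) (- m) \<partial>M)"
      using f g by (intro integral_mono bcont_integrable[OF M]) auto
    ultimately show "(\<integral>a. f a \<partial>M) \<le> \<alpha>" by linarith
  next
    assume *: "\<forall>f\<in>bcont A. (\<forall>a\<in>A. f a \<le> \<phi> a) \<longrightarrow> (\<integral>a. f a \<partial>M) \<le> \<alpha>"
    obtain F where F: "\<And>n. F n \<in> bcont A"
        "\<And>n a. a \<in> A \<Longrightarrow> - m \<le> F n a" "\<And>n a. a \<in> A \<Longrightarrow> F n a \<le> \<phi> a"
        "\<And>a. a \<in> A \<Longrightarrow> incseq (\<lambda>n. F n a)" "\<And>a. a \<in> A \<Longrightarrow> (\<lambda>n. F n a) \<longlonglongrightarrow> \<phi> a"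
      using lsc_on_approx_bcont[OF lsc m(1) m(3)] by blast
    have "(\<integral>\<^sup>+x. ennreal (\<phi> x + m) \<partial>M) = (\<integral>\<^sup>+x. (SUP n. ennreal (F n x + m)) \<partial>M)"
    proof (rule nn_integral_cong)
      fix x assume "x \<in> space M"
      then have x: "x \<in> A" by (simp add: sp)
      have "incseq (\<lambda>n. ennreal (F n x + m))"
        using F(4)[OF x] by (auto simp: incseq_def intro!: ennreal_leI)
      then have "(\<lambda>n. ennreal (F n x + m)) \<longlonglongrightarrow> (SUP n. ennreal (F n x + m))" by (rule LIMSEQ_SUP)
      moreover have "(\<lambda>n. ennreal (F n x + m)) \<longlonglongrightarrow> ennreal (\<phi> x + m)"
        by (intro tendsto_intros F(5) x)
      ultimately show "ennreal (\<phi> x + m) = (SUP n. ennreal (F n x + m))"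
        using LIMSEQ_unique by blast
    qed
    also have "\<dots> = (SUP n. \<integral>\<^sup>+x. ennreal (F n x + m) \<partial>M)"
    proof (rule nn_integral_monotone_convergence_SUP_AE)
      show "AE x in M. ennreal (F n x + m) \<le> ennreal (F (Suc n) x + m)" for n
        using F(4) sp by (intro AE_I2) (auto simp: incseq_Suc_iff intro!: ennreal_leI)
      show "(\<lambda>x. ennreal (F n x + m)) \<in> borel_measurable M" for n
        using bcont_integrable[OF M F(1)[of n]] by measurable
    qed
    also have "\<dots> \<le> ennreal (\<alpha> + m)"
    proof (rule SUP_least)
      fix n
      have "(\<integral>a. F n a \<partial>M) \<le> \<alpha>" using * F(1,3) by blast
      then show "(\<integral>\<^sup>+x. ennreal (F n x + m) \<partial>M) \<le> ennreal (\<alpha> + m)"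
        using shift[OF F(1) F(2)] by (simp add: ennreal_leI)
    qed
    finally show "(\<integral>\<^sup>+x. ennreal (\<phi> x + m) \<partial>M) \<le> ennreal (\<alpha> + m)" .
  qed
qed

lemma ext_integral_eq_integral:
  assumes "integrable M \<phi>"
  shows "ext_integral M \<phi> = ereal (\<integral>x. \<phi> x \<partial>M)"
proof -
  have "(\<integral>\<^sup>+x. ennreal (\<phi> x) \<partial>M) \<noteq> \<infinity>" "(\<integral>\<^sup>+x. ennreal (- \<phi> x) \<partial>M) \<noteq> \<infinity>"
    using assms by (auto simp: real_integrable_def)
  then show ?thesis
    unfolding ext_integral_def real_lebesgue_integral_def[OF assms]
    by (cases "\<integral>\<^sup>+x. ennreal (\<phi> x) \<partial>M"; cases "\<integral>\<^sup>+x. ennreal (- \<phi> x) \<partial>M") auto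
qed

section \<open>The Daniell representation theorem\<close>

lemma bcont_cong:
  assumes "f \<in> bcont S" "\<And>x. x \<in> S \<Longrightarrow> g x = f x"
  shows "g \<in> bcont S"
proof -
  have "continuous_on S g \<longleftrightarrow> continuous_on S f" "g ` S = f ` S"
    using assms(2) by (auto intro!: continuous_on_cong)
  then show ?thesis using assms(1) by (simp add: bcont_def)
qed

lemma bcont_sum:
  "finite I \<Longrightarrow> (\<And>i. i \<in> I \<Longrightarrow> f i \<in> bcont S) \<Longrightarrow> (\<lambda>x. \<Sum>i\<in>I. f i x) \<in> bcont S"
  by (induction rule: finite_induct) (auto intro: bcont_add)

text \<open>A number \<open>x \<ge> 0\<close> is cut at the levels \<open>0, 1/n, 2/n, \<dots>\<close>; the portion of \<open>x\<close> between the levels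
\<open>k/n\<close> and \<open>(k+1)/n\<close> is the \<open>k\<close>-th summand.\<close>
lemma min_layers:
  fixes x :: real
  assumes "0 \<le> x" "0 < n"
  shows "(\<Sum>k<j. min (max (x - real k / real n) 0) (1 / real n)) = min x (real j / real n)"
proof (induction j)
  case 0 then show ?case using assms by simp
next
  case (Suc j)
  have "real (Suc j) / real n = real j / real n + 1 / real n"
    by (simp add: add_divide_distrib)
  moreover have "0 < 1 / real n" using assms by simp
  ultimately show ?case using Suc \<open>0 \<le> x\<close> unfolding sum.lessThan_Suc by linarith
qed

text \<open>Counting each nonempty layer with its full height \<open>1/n\<close> overestimates \<open>x\<close> by at most one layer.
The second bound is carried along to close the induction.\<close>
lemma indicator_layers_le:
  fixes x :: real
  assumes "0 \<le> x" "0 < n"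
  shows "(\<Sum>k<j. of_bool (real k / real n < x) / real n) \<le> x + 1 / real n \<and>
         (\<Sum>k<j. of_bool (real k / real n < x) / real n) \<le> real j / real n"
proof (induction j)
  case 0 then show ?case using assms by simp
next
  case (Suc j)
  have "real (Suc j) / real n = real j / real n + 1 / real n" "0 < 1 / real n"
    using assms by (auto simp: add_divide_distrib)
  then show ?case using Suc by (cases "real j / real n < x") auto
qed

text \<open>Positive normalized linear functionals that are continuous under decreasing limits. Daniell's
theorem says that they are integrals. The construction below is the one through the product with an
interval: on \<open>A \<times> [0, 1)\<close> the regions between two graphs form a semiring, \<open>L\<close> assigns to each the value of
the difference of the bounding functions, and projecting the Caratheodory extension to \<open>A\<close> gives the
measure.\<close>
locale daniell_functional =
  fixes A :: "'a::metric_space set" and L :: "('a \<Rightarrow> real) \<Rightarrow> real"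
  assumes L_add: "\<And>f g. f \<in> bcont A \<Longrightarrow> g \<in> bcont A \<Longrightarrow> L (\<lambda>x. f x + g x) = L f + L g"
    and L_cmult: "\<And>f k. f \<in> bcont A \<Longrightarrow> L (\<lambda>x. k * f x) = k * L f"
    and L_nonneg: "\<And>f. f \<in> bcont A \<Longrightarrow> (\<And>a. a \<in> A \<Longrightarrow> 0 \<le> f a) \<Longrightarrow> 0 \<le> L f"
    and L_one: "L (\<lambda>_. 1) = 1"
    and L_cont: "\<And>F :: nat \<Rightarrow> 'a \<Rightarrow> real. (\<And>n. F n \<in> bcont A) \<Longrightarrow> (\<And>a. a \<in> A \<Longrightarrow> decseq (\<lambda>n. F n a)) \<Longrightarrow>
       (\<And>a. a \<in> A \<Longrightarrow> (\<lambda>n. F n a) \<longlonglongrightarrow> 0) \<Longrightarrow> (\<lambda>n. L (F n)) \<longlonglongrightarrow> 0"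
begin

lemma L_diff: "f \<in> bcont A \<Longrightarrow> g \<in> bcont A \<Longrightarrow> L (\<lambda>x. f x - g x) = L f - L g"
  using L_add[OF _ bcont_cmult, of f g "-1"] L_cmult[of g "-1"] by simp

lemma L_mono: "f \<in> bcont A \<Longrightarrow> g \<in> bcont A \<Longrightarrow> (\<And>a. a \<in> A \<Longrightarrow> f a \<le> g a) \<Longrightarrow> L f \<le> L g"
  using L_nonneg[of "\<lambda>x. g x - f x"] L_diff[of g f] bcont_diff[of g A f] by force

lemma L_cong: "f \<in> bcont A \<Longrightarrow> (\<And>a. a \<in> A \<Longrightarrow> g a = f a) \<Longrightarrow> L g = L f"
  using L_mono[of f g] L_mono[of g f] bcont_cong[of f A g] by force

lemma L_zero: "L (\<lambda>_. 0) = 0"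
  using L_cmult[of "\<lambda>_. 0" 0] by simp

lemma L_sum:
  "finite I \<Longrightarrow> (\<And>i. i \<in> I \<Longrightarrow> f i \<in> bcont A) \<Longrightarrow> L (\<lambda>x. \<Sum>i\<in>I. f i x) = (\<Sum>i\<in>I. L (f i))"
  by (induction rule: finite_induct) (auto simp: L_zero L_add bcont_sum)

definition strip :: "('a \<Rightarrow> real) \<Rightarrow> ('a \<Rightarrow> real) \<Rightarrow> ('a \<times> real) set" where
  "strip f g = {(a, t). a \<in> A \<and> f a \<le> t \<and> t < g a}"

definition ordered_unit :: "('a \<Rightarrow> real) \<Rightarrow> ('a \<Rightarrow> real) \<Rightarrow> bool" where
  "ordered_unit f g \<longleftrightarrow> f \<in> bcont A \<and> g \<in> bcont A \<and> (\<forall>a\<in>A. 0 \<le> f a \<and> f a \<le> g a \<and> g a \<le> 1)"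

definition strips :: "('a \<times> real) set set" where
  "strips = {strip f g | f g. ordered_unit f g}"

text \<open>Reading off the height \<open>g - f\<close> from the set itself avoids the question whether \<open>f\<close> and \<open>g\<close> are
determined by it: where the strip is empty they are not.\<close>
definition content :: "('a \<times> real) set \<Rightarrow> ennreal" where
  "content S = ennreal (L (\<lambda>a. measure lborel (Pair a -` S)))"

lemma section_strip: "a \<in> A \<Longrightarrow> Pair a -` strip f g = {f a..<g a}"
  by (auto simp: strip_def)

lemma content_strip:
  assumes "ordered_unit f g"
  shows "content (strip f g) = ennreal (L (\<lambda>a. g a - f a))"
proof -
  have "L (\<lambda>a. measure lborel (Pair a -` strip f g)) = L (\<lambda>a. g a - f a)"
    using assms by (intro L_cong bcont_diff) (auto simp: ordered_unit_def section_strip)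
  then show ?thesis by (simp add: content_def)
qed

lemma stripsI: "ordered_unit f g \<Longrightarrow> strip f g \<in> strips"
  unfolding strips_def by blast

text \<open>Over each point the strips are half-open intervals. The maxima and minima below clip the interval
bounds so that they remain in order when an intersection or difference is empty.\<close>
lemma semiring_strips: "semiring_of_sets (A \<times> {0..<1}) strips"
proof
  show "strips \<subseteq> Pow (A \<times> {0..<1})"
    unfolding strips_def strip_def ordered_unit_def by fastforce
  have "ordered_unit (\<lambda>_. 0) (\<lambda>_. 0)" by (simp add: ordered_unit_def)
  moreover have "strip (\<lambda>_. 0) (\<lambda>_. 0) = {}" by (auto simp: strip_def)
  ultimately show "{} \<in> strips" by (metis stripsI)
next
  fix X Y assume "X \<in> strips" "Y \<in> strips"
  then obtain f g f' g' where X: "X = strip f g" "ordered_unit f g" and Y: "Y = strip f' g'" "ordered_unit f' g'"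
    unfolding strips_def by auto
  have "X \<inter> Y = strip (\<lambda>a. max (f a) (f' a)) (\<lambda>a. max (max (f a) (f' a)) (min (g a) (g' a)))"
    unfolding X Y strip_def by auto
  moreover have "ordered_unit (\<lambda>a. max (f a) (f' a)) (\<lambda>a. max (max (f a) (f' a)) (min (g a) (g' a)))"
    using X(2) Y(2) unfolding ordered_unit_def by (auto intro!: bcont_max bcont_min intro: order_trans)
  ultimately show "X \<inter> Y \<in> strips" by (metis stripsI)
  define lo where "lo = (\<lambda>a. max (f a) (min (g a) (f' a)))"
  define hi where "hi = (\<lambda>a. min (g a) (max (f a) (g' a)))"
  have "ordered_unit f lo" "ordered_unit hi g"
    using X(2) Y(2) unfolding ordered_unit_def lo_def hi_def
    by (auto intro!: bcont_max bcont_min intro: order_trans)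
  moreover have "X - Y = \<Union> {strip f lo, strip hi g}"
    using X(2) Y(2) unfolding X(1) Y(1) strip_def lo_def hi_def ordered_unit_def by auto
  moreover have "strip f lo \<inter> strip hi g = {}"
    using X(2) Y(2) unfolding strip_def lo_def hi_def ordered_unit_def by fastforce
  ultimately show "\<exists>C\<subseteq>strips. finite C \<and> disjoint C \<and> X - Y = \<Union> C"
    by (intro exI[of _ "{strip f lo, strip hi g}"]) (auto simp: stripsI pairwise_def disjnt_def)
qed

text \<open>Over each point this is the countable additivity of length. So the heights of the pieces add up
pointwise to the height of the union, and the remainders decrease to \<open>0\<close>, which is where continuity of
\<open>L\<close> enters.\<close>
lemma content_countably_additive: "countably_additive strips content"
proof (rule countably_additiveI)
  fix S :: "nat \<Rightarrow> ('a \<times> real) set"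
  assume S: "range S \<subseteq> strips" "disjoint_family S" "(\<Union>i. S i) \<in> strips"
  have "\<forall>i. \<exists>f g. S i = strip f g \<and> ordered_unit f g"
    using S(1) unfolding strips_def by blast
  then obtain f g where fg: "\<And>i. S i = strip (f i) (g i)" "\<And>i. ordered_unit (f i) (g i)" by metis
  obtain F G where FG: "(\<Union>i. S i) = strip F G" "ordered_unit F G"
    using S(3) unfolding strips_def by blast
  define h where "h i a = g i a - f i a" for i a
  define H where "H a = G a - F a" for a
  have h: "h i \<in> bcont A" and H: "H \<in> bcont A" for i
    using fg(2) FG(2) unfolding h_def H_def ordered_unit_def by (auto intro: bcont_diff)
  have h0: "0 \<le> h i a" and H0: "0 \<le> H a" if "a \<in> A" for i a
    using fg(2) FG(2) that unfolding h_def H_def ordered_unit_def by auto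
  have sums: "(\<lambda>i. h i a) sums H a" if a: "a \<in> A" for a
  proof -
    have "(\<Sum>i. emeasure lborel (Pair a -` S i)) = emeasure lborel (\<Union>i. Pair a -` S i)"
    proof (rule suminf_emeasure)
      show "range (\<lambda>i. Pair a -` S i) \<subseteq> sets lborel" using fg(1) section_strip[OF a] by auto
      show "disjoint_family (\<lambda>i. Pair a -` S i)" using S(2) unfolding disjoint_family_on_def by blast
    qed
    also have "(\<Union>i. Pair a -` S i) = Pair a -` strip F G"
      unfolding FG(1)[symmetric] by auto
    finally have "(\<Sum>i. ennreal (h i a)) = ennreal (H a)"
      using a fg FG by (auto simp: h_def H_def section_strip ordered_unit_def)
    then have "(\<lambda>i. ennreal (h i a)) sums ennreal (H a)"
      by (metis summableI summable_sums)
    then show ?thesis using h0[OF a] H0[OF a] by (simp add: sums_ennreal)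
  qed
  have "(\<lambda>n. L (\<lambda>a. H a - (\<Sum>i<n. h i a))) \<longlonglongrightarrow> 0"
  proof (rule L_cont)
    show "(\<lambda>a. H a - (\<Sum>i<n. h i a)) \<in> bcont A" for n
      using h H by (intro bcont_diff bcont_sum) auto
    show "decseq (\<lambda>n. H a - (\<Sum>i<n. h i a))" if "a \<in> A" for a
      using h0[OF that] by (intro decseq_SucI) simp
    show "(\<lambda>n. H a - (\<Sum>i<n. h i a)) \<longlonglongrightarrow> 0" if "a \<in> A" for a
      using tendsto_diff[OF tendsto_const sums[OF that, unfolded sums_def], of "H a"] by simp
  qed
  moreover have "L (\<lambda>a. H a - (\<Sum>i<n. h i a)) = L H - (\<Sum>i<n. L (h i))" for n
    using h H by (subst L_diff) (auto simp: L_sum bcont_sum)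
  ultimately have "(\<lambda>n. L H - (L H - (\<Sum>i<n. L (h i)))) \<longlonglongrightarrow> L H - 0"
    by (intro tendsto_diff tendsto_const) simp
  then have "(\<lambda>i. L (h i)) sums L H" by (simp add: sums_def)
  moreover have "0 \<le> L (h i)" "0 \<le> L H" for i using h H h0 H0 by (auto intro!: L_nonneg)
  ultimately have "(\<lambda>i. ennreal (L (h i))) sums ennreal (L H)" by simp
  moreover have "content (S i) = ennreal (L (h i))" for i
    using fg content_strip[of "f i" "g i"] unfolding h_def by simp
  moreover have "content (\<Union>i. S i) = ennreal (L H)"
    using FG content_strip[of F G] unfolding H_def by simp
  ultimately show "(\<Sum>i. content (S i)) = content (\<Union>i. S i)" by (simp add: sums_iff)
qed

lemma obtain_strip_measure:
  obtains N where "space N = A \<times> {0..<1}" "\<And>S. S \<in> strips \<Longrightarrow> S \<in> sets N"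
    "\<And>f g. ordered_unit f g \<Longrightarrow> emeasure N (strip f g) = ennreal (L (\<lambda>a. g a - f a))"
proof -
  interpret semiring_of_sets "A \<times> {0..<1}" strips by (rule semiring_strips)
  have "positive strips content"
    by (simp add: positive_def content_def L_zero)
  from caratheodory[OF this content_countably_additive] obtain \<mu> where
    \<mu>: "\<And>S. S \<in> strips \<Longrightarrow> \<mu> S = content S"
       "measure_space (A \<times> {0..<1}) (sigma_sets (A \<times> {0..<1}) strips) \<mu>" by auto
  define N where "N = measure_of (A \<times> {0..<1}) strips \<mu>"
  have N: "space N = A \<times> {0..<1}" "sets N = sigma_sets (A \<times> {0..<1}) strips"
    using space_closed unfolding N_def by auto
  have "emeasure N S = \<mu> S" if "S \<in> strips" for S
    using \<mu>(2) that space_closed N(2)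
    by (intro emeasure_measure_of[OF N_def]) (auto simp: measure_space_def)
  then show thesis
    using N by (intro that[of N]) (auto simp: \<mu> content_strip stripsI)
qed

text \<open>The projection \<open>fst\<close> is measurable because the cylinder over an open set \<open>U\<close> is the union of the
regions below the functions \<open>min 1 (n \<cdot> infdist a (- U))\<close>. Slicing a function \<open>f\<close> with values in \<open>[0, 1]\<close> into \<open>n\<close> layers, and bounding
\<open>L\<close> of each layer by the measure of the set where it does not vanish, gives \<open>L f \<le> \<integral>f dM + 1/n\<close>. The
reverse inequality is the same one for \<open>1 - f\<close>.\<close>
theorem representing_measure:
  obtains M where "M \<in> borel_probs A" "\<And>f. f \<in> bcont A \<Longrightarrow> (\<integral>a. f a \<partial>M) = L f"
proof -
  obtain N where N: "space N = A \<times> {0..<1}" "\<And>S. S \<in> strips \<Longrightarrow> S \<in> sets N"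
      "\<And>f g. ordered_unit f g \<Longrightarrow> emeasure N (strip f g) = ennreal (L (\<lambda>a. g a - f a))"
    using obtain_strip_measure by blast
  have cylinder: "(A \<inter> U) \<times> {0..<1} \<in> sets N" if "open U" for U
  proof (cases "U = UNIV")
    case True
    have "(A \<inter> U) \<times> {0..<1} = space N" using True N(1) by simp
    then show ?thesis by simp
  next
    case False
    define g where "g n a = min 1 (real n * infdist a (- U))" for n :: nat and a
    have g: "ordered_unit (\<lambda>_. 0) (g n)" for n
      unfolding ordered_unit_def g_def
    proof (intro conjI ballI bcontI[where K = 1])
      show "continuous_on A (\<lambda>a. min 1 (real n * infdist a (- U)))"
        by (intro continuous_intros)
    qed (auto simp: infdist_nonneg)
    have "(A \<inter> U) \<times> {0..<1} = (\<Union>n. strip (\<lambda>_. 0) (g n))"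
    proof (intro equalityI subsetI)
      fix p assume "p \<in> (A \<inter> U) \<times> {0..<1::real}"
      then obtain a t where p: "p = (a, t)" "a \<in> A" "a \<in> U" "0 \<le> t" "t < 1" by auto
      have "0 < infdist a (- U)"
        using that p(3) False by (metis Compl_UNIV_eq Compl_iff closed_Compl double_complement
            in_closed_iff_infdist_zero infdist_nonneg order_le_imp_less_or_eq)
      then obtain n :: nat where "1 < real n * infdist a (- U)"
        using ex_less_of_nat_mult by blast
      then have "p \<in> strip (\<lambda>_. 0) (g n)" using p by (auto simp: strip_def g_def)
      then show "p \<in> (\<Union>n. strip (\<lambda>_. 0) (g n))" by blast
    next
      fix p assume "p \<in> (\<Union>n. strip (\<lambda>_. 0) (g n))"
      then obtain n a t where p: "p = (a, t)" "a \<in> A" "0 \<le> t" "t < g n a" by (auto simp: strip_def)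
      then have "a \<in> U" by (cases "a \<in> U") (auto simp: g_def)
      then show "p \<in> (A \<inter> U) \<times> {0..<1}" using p by (auto simp: g_def)
    qed
    also have "\<dots> \<in> sets N" using N(2)[OF stripsI[OF g]] by auto
    finally show ?thesis .
  qed
  define M where "M = distr N (restrict_space borel A) fst"
  have [measurable]: "fst \<in> measurable N (restrict_space borel A)"
  proof (rule measurable_restrict_space2)
    show "fst \<in> space N \<rightarrow> A" using N(1) by auto
    show "fst \<in> borel_measurable N"
    proof (rule borel_measurableI)
      fix U :: "'a set" assume "open U"
      moreover have "fst -` U \<inter> space N = (A \<inter> U) \<times> {0..<1}" using N(1) by auto
      ultimately show "fst -` U \<inter> space N \<in> sets N" using cylinder by simp
    qed
  qed
  have "emeasure N (space N) = 1"
  proof -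
    have "ordered_unit (\<lambda>_. 0) (\<lambda>_. 1)" by (simp add: ordered_unit_def)
    moreover have "strip (\<lambda>_. 0) (\<lambda>_. 1) = space N" unfolding N(1) by (auto simp: strip_def)
    ultimately show ?thesis using N(3)[of "\<lambda>_. 0" "\<lambda>_. 1"] by (simp add: L_one)
  qed
  then interpret N: prob_space N by (rule prob_spaceI)
  interpret M: prob_space M unfolding M_def by (rule N.prob_space_distr) simp
  have M: "M \<in> borel_probs A"
    unfolding borel_probs_iff by (simp add: M_def M.prob_space_axioms[unfolded M_def])
  have sp: "space M = A" using borel_probs_space[OF M] .
  have pos_set: "{a\<in>A. 0 < h a} \<in> sets M" if "h \<in> bcont A" for h
  proof -
    have [measurable]: "h \<in> borel_measurable M" using bcont_integrable[OF M that] by auto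
    show ?thesis unfolding sp[symmetric] by measurable
  qed
  have L_le_measure: "L h \<le> measure M {a\<in>A. 0 < h a}"
    if h: "h \<in> bcont A" "\<And>a. a \<in> A \<Longrightarrow> 0 \<le> h a" "\<And>a. a \<in> A \<Longrightarrow> h a \<le> 1" for h
  proof -
    have "ennreal (L h) = emeasure N (strip (\<lambda>_. 0) h)"
      using N(3)[of "\<lambda>_. 0" h] h by (simp add: ordered_unit_def)
    also have "\<dots> \<le> emeasure N (fst -` {a\<in>A. 0 < h a} \<inter> space N)"
    proof (rule emeasure_mono)
      show "strip (\<lambda>_. 0) h \<subseteq> fst -` {a\<in>A. 0 < h a} \<inter> space N"
        using h(3) unfolding N(1) strip_def by fastforce
      show "fst -` {a\<in>A. 0 < h a} \<inter> space N \<in> sets N"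
        using pos_set[OF h(1)] unfolding M_def sets_distr by (rule measurable_sets[rotated]) simp
    qed
    also have "\<dots> = emeasure M {a\<in>A. 0 < h a}"
      using pos_set[OF h(1)] unfolding M_def by (subst emeasure_distr) auto
    finally show ?thesis by (simp add: M.emeasure_eq_measure)
  qed
  have approx: "L f \<le> (\<integral>a. f a \<partial>M) + 1 / real n"
    if f: "f \<in> bcont A" "\<And>a. a \<in> A \<Longrightarrow> 0 \<le> f a" "\<And>a. a \<in> A \<Longrightarrow> f a \<le> 1" and n: "0 < n" for f n
  proof -
    define u where "u k a = min (max (f a - real k / real n) 0) (1 / real n)" for k a
    have u: "u k \<in> bcont A" for k
      unfolding u_def by (intro bcont_min bcont_max bcont_diff f bcont_const)
    have meas[measurable]: "{a\<in>A. real k / real n < f a} \<in> sets M" for k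
      using pos_set[of "\<lambda>a. f a - real k / real n"] f(1) by (simp add: bcont_diff)
    have "L f = L (\<lambda>a. \<Sum>k<n. u k a)"
    proof (rule L_cong)
      show "(\<lambda>a. \<Sum>k<n. u k a) \<in> bcont A" using u by (intro bcont_sum) auto
      show "f a = (\<Sum>k<n. u k a)" if "a \<in> A" for a
        using min_layers[of "f a" n n] f that n unfolding u_def by simp
    qed
    also have "\<dots> = (\<Sum>k<n. L (u k))" using u by (intro L_sum) auto
    also have "\<dots> \<le> (\<Sum>k<n. measure M {a\<in>A. real k / real n < f a} / real n)"
    proof (rule sum_mono)
      fix k
      have "real n * L (u k) = L (\<lambda>a. real n * u k a)" using L_cmult[OF u] by simp
      also have "\<dots> \<le> measure M {a\<in>A. 0 < real n * u k a}"
      proof (rule L_le_measure)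
        show "(\<lambda>a. real n * u k a) \<in> bcont A" by (intro bcont_cmult u)
        show "0 \<le> real n * u k a" for a unfolding u_def using n by simp
        have "u k a \<le> 1 / real n" for a unfolding u_def by simp
        then show "real n * u k a \<le> 1" for a using n by (simp add: field_simps)
      qed
      also have "{a\<in>A. 0 < real n * u k a} = {a\<in>A. real k / real n < f a}"
        using n unfolding u_def by (auto simp: zero_less_mult_iff)
      finally show "L (u k) \<le> measure M {a\<in>A. real k / real n < f a} / real n"
        using n by (simp add: field_simps)
    qed
    also have "\<dots> = (\<integral>a. (\<Sum>k<n. indicator {a\<in>A. real k / real n < f a} a / real n) \<partial>M)"
      using sp by (subst Bochner_Integration.integral_sum) (auto simp: less_top[symmetric] intro!: sum.cong arg_cong[where f = "measure M"])
    also have "\<dots> \<le> (\<integral>a. f a + 1 / real n \<partial>M)"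
    proof (rule integral_mono)
      show "integrable M (\<lambda>a. \<Sum>k<n. indicator {a\<in>A. real k / real n < f a} a / real n)"
        by (intro Bochner_Integration.integrable_sum integrable_divide integrable_real_indicator) (auto simp: less_top[symmetric])
      show "integrable M (\<lambda>a. f a + 1 / real n)" using bcont_integrable[OF M f(1)] by simp
      fix a assume "a \<in> space M"
      then have a: "a \<in> A" using sp by simp
      have "(\<Sum>k<n. indicator {a\<in>A. real k / real n < f a} a / real n)
          = (\<Sum>k<n. of_bool (real k / real n < f a) / real n)"
        using a by (intro sum.cong) (auto simp: indicator_def)
      then show "(\<Sum>k<n. indicator {a\<in>A. real k / real n < f a} a / real n) \<le> f a + 1 / real n"
        using indicator_layers_le[of "f a" n n] f(2)[OF a] n by simp
    qed
    also have "\<dots> = (\<integral>a. f a \<partial>M) + 1 / real n"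
      using bcont_integrable[OF M f(1)] by (subst Bochner_Integration.integral_add) (auto simp: M.prob_space)
    finally show ?thesis .
  qed
  have le: "L f \<le> (\<integral>a. f a \<partial>M)"
    if f: "f \<in> bcont A" "\<And>a. a \<in> A \<Longrightarrow> 0 \<le> f a" "\<And>a. a \<in> A \<Longrightarrow> f a \<le> 1" for f
  proof (rule LIMSEQ_le_const)
    show "(\<lambda>n. (\<integral>a. f a \<partial>M) + 1 / real n) \<longlonglongrightarrow> (\<integral>a. f a \<partial>M)"
      using tendsto_add[OF tendsto_const lim_1_over_n] by fastforce
    show "\<exists>n0. \<forall>n\<ge>n0. L f \<le> (\<integral>a. f a \<partial>M) + 1 / real n"
      using approx[OF f] by (intro exI[of _ 1]) auto
  qed
  have unit: "(\<integral>a. f a \<partial>M) = L f"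
    if f: "f \<in> bcont A" "\<And>a. a \<in> A \<Longrightarrow> 0 \<le> f a" "\<And>a. a \<in> A \<Longrightarrow> f a \<le> 1" for f
  proof -
    have "L (\<lambda>a. 1 - f a) \<le> (\<integral>a. 1 - f a \<partial>M)"
      using f by (intro le bcont_diff) auto
    then have "1 - L f \<le> 1 - (\<integral>a. f a \<partial>M)"
      using f(1) bcont_integrable[OF M f(1)] by (simp add: L_diff L_one M.prob_space)
    then show ?thesis using le[OF f] by linarith
  qed
  show thesis
  proof (rule that[OF M])
    fix f assume f: "f \<in> bcont A"
    obtain K0 where K0: "0 \<le> K0" "\<And>a. a \<in> A \<Longrightarrow> \<bar>f a\<bar> \<le> K0" using f by (metis bcontE)
    \<comment> \<open>An affine change of scale into \<open>[0, 1]\<close>; the \<open>+ 1\<close> excludes division by \<open>0\<close>.\<close>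
    define K where "K = K0 + 1"
    have K: "0 < K" "\<And>a. a \<in> A \<Longrightarrow> \<bar>f a\<bar> \<le> K" using K0 by (auto simp: K_def intro: add_increasing2)
    define g where "g a = (1 / (2 * K)) * (f a + K)" for a
    have g: "g \<in> bcont A" unfolding g_def by (intro bcont_cmult bcont_add f bcont_const)
    have "0 \<le> g a" "g a \<le> 1" if "a \<in> A" for a
      using K(1) K(2)[OF that] unfolding g_def by (auto simp: field_simps abs_le_iff)
    then have eq: "(\<integral>a. g a \<partial>M) = L g" by (intro unit g) auto
    have fg: "f = (\<lambda>a. (2 * K) * g a + - K * 1)" using K(1) unfolding g_def by (auto simp: field_simps)
    have "L f = 2 * K * L g + - K"
      by (subst fg, subst L_add) (use g L_cmult[of "\<lambda>_. 1" "- K"] in \<open>auto simp: L_cmult L_one bcont_cmult\<close>)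
    moreover have "(\<integral>a. f a \<partial>M) = 2 * K * (\<integral>a. g a \<partial>M) + - K"
      by (subst fg) (use bcont_integrable[OF M g] in \<open>simp add: M.prob_space\<close>)
    ultimately show "(\<integral>a. f a \<partial>M) = L f" using eq by simp
  qed
qed

end

section \<open>Compact sets of probability measures\<close>

text \<open>The weak topology is the initial topology of the map that sends a measure to the family of its
integrals; every weakly open set is thus the preimage of an open set of the product.\<close>
lemma openin_weak_topology_evaluation:
  assumes "openin (weak_topology A) V"
  shows "\<exists>W. openin (product_topology (\<lambda>_. euclideanreal) (bcont A)) W \<and>
    (\<forall>M. M \<in> V \<longleftrightarrow> M \<in> borel_probs A \<and> (\<lambda>f\<in>bcont A. \<integral>a. f a \<partial>M) \<in> W)"
proof -
  define e where "e M = (\<lambda>f\<in>bcont A. \<integral>a. f a \<partial>M)" for M :: "'a measure"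
  define X where "X = product_topology (\<lambda>_::'a \<Rightarrow> real. euclideanreal) (bcont A)"
  have "generate_topology_on {{M \<in> borel_probs A. (\<integral>s. f s \<partial>M) \<in> U} | (f :: 'a \<Rightarrow> real) U.
        continuous_on A f \<and> bounded (f ` A) \<and> open U} V"
    using assms unfolding weak_topology_def by (rule openin_topology_generated_by)
  then have "\<exists>W. openin X W \<and> (\<forall>M. M \<in> V \<longleftrightarrow> M \<in> borel_probs A \<and> e M \<in> W)"
  proof induction
    case Empty
    show ?case by (intro exI[of _ "{}"]) auto
  next
    case (Int V1 V2)
    obtain W1 where W1: "openin X W1" "\<forall>M. M \<in> V1 \<longleftrightarrow> M \<in> borel_probs A \<and> e M \<in> W1"
      using Int.IH(1) by blast
    obtain W2 where W2: "openin X W2" "\<forall>M. M \<in> V2 \<longleftrightarrow> M \<in> borel_probs A \<and> e M \<in> W2"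
      using Int.IH(2) by blast
    show ?case
      using W1(2) W2(2) by (intro exI[of _ "W1 \<inter> W2"] conjI openin_Int W1(1) W2(1)) auto
  next
    case (UN K)
    then have "\<forall>V\<in>K. \<exists>W. openin X W \<and> (\<forall>M. M \<in> V \<longleftrightarrow> M \<in> borel_probs A \<and> e M \<in> W)" by blast
    from bchoice[OF this] obtain W where
      W: "\<forall>V\<in>K. openin X (W V) \<and> (\<forall>M. M \<in> V \<longleftrightarrow> M \<in> borel_probs A \<and> e M \<in> W V)" by (elim exE)
    show ?case
    proof (intro exI[of _ "\<Union> (W ` K)"] conjI allI)
      show "openin X (\<Union> (W ` K))" using W by auto
      show "M \<in> \<Union> K \<longleftrightarrow> M \<in> borel_probs A \<and> e M \<in> \<Union> (W ` K)" for M
        using W by blast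
    qed
  next
    case (Basis V)
    then obtain f U where f: "V = {M \<in> borel_probs A. (\<integral>s. f s \<partial>M) \<in> U}" "f \<in> bcont A" "open U"
      by (auto simp: bcont_def)
    have "continuous_map X euclideanreal (\<lambda>x. x f)"
      unfolding X_def using f(2) by (rule continuous_map_product_projection)
    then have "openin X {x \<in> topspace X. x f \<in> U}"
      using f(3) by (intro openin_continuous_map_preimage) auto
    moreover have "M \<in> V \<longleftrightarrow> M \<in> borel_probs A \<and> e M \<in> {x \<in> topspace X. x f \<in> U}" for M
      unfolding f(1) using f(2) by (auto simp: e_def X_def)
    ultimately show ?case by blast
  qed
  then show ?thesis unfolding e_def X_def .
qed

text \<open>The single schema ``\<open>f \<le> s + t \<phi>\<close> with \<open>t \<ge> 0\<close> implies \<open>x f \<le> s + t l\<close>'' in the set \<open>T\<close> below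
records everything about the sublevel set that has to survive passing to limits: with \<open>t = 0\<close> it gives
positivity and total mass \<open>1\<close>; with \<open>s = 0\<close> and \<open>t = 1\<close> it returns the bound on the integral of \<open>\<phi>\<close>; and
for general \<open>t\<close> it is the Markov inequality that expresses tightness and yields continuity under
decreasing limits.\<close>
theorem compactin_ext_integral_sublevel:
  fixes \<phi> :: "'a::metric_space \<Rightarrow> real"
  assumes lsc: "lsc_on A (\<lambda>a. ereal (\<phi> a))"
    and meas: "\<phi> \<in> borel_measurable (restrict_space borel A)"
    and bdd: "bdd_below (\<phi> ` A)"
    and inf_compact: "inf_compact_on A (\<lambda>a. ereal (\<phi> a))"
  shows "compactin (weak_topology A) {M \<in> borel_probs A. ext_integral M \<phi> \<le> ereal l}"
proof -
  define C where "C = {M \<in> borel_probs A. ext_integral M \<phi> \<le> ereal l}"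
  define e where "e M = (\<lambda>f\<in>bcont A. \<integral>a. f a \<partial>M)" for M :: "'a measure"
  define X where "X = product_topology (\<lambda>_::'a \<Rightarrow> real. euclideanreal) (bcont A)"
  obtain m0 where m0: "\<And>a. a \<in> A \<Longrightarrow> m0 \<le> \<phi> a" using bdd by (auto simp: bdd_below_def)
  define m where "m = \<bar>m0\<bar> + \<bar>l\<bar>"
  have m: "m \<ge> 0" "0 \<le> l + m" "\<And>a. a \<in> A \<Longrightarrow> - m \<le> \<phi> a"
    using m0 unfolding m_def by fastforce+
  define T where "T = {x \<in> topspace X.
      (\<forall>f\<in>bcont A. \<forall>g\<in>bcont A. x (\<lambda>a. f a + g a) = x f + x g) \<and>
      (\<forall>f\<in>bcont A. \<forall>k. x (\<lambda>a. k * f a) = k * x f) \<and>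
      (\<forall>f\<in>bcont A. \<forall>s. \<forall>t\<ge>0. (\<forall>a\<in>A. f a \<le> s + t * \<phi> a) \<longrightarrow> x f \<le> s + t * l)}"
  have proj: "continuous_map X euclideanreal (\<lambda>x. x f)" if "f \<in> bcont A" for f
    unfolding X_def using that by (rule continuous_map_product_projection)
  have closed_T: "closedin X T"
  proof -
    have eq: "closedin X {x \<in> topspace X. p x = q x}"
      if "continuous_map X euclideanreal p" "continuous_map X euclideanreal q" for p q
    proof -
      have "closedin X {x \<in> topspace X. p x - q x \<in> {0}}"
        by (rule closedin_continuous_map_preimage[where Y = euclideanreal])
           (auto intro!: continuous_map_diff that)
      then show ?thesis by simp
    qed
    have le: "closedin X {x \<in> topspace X. p x \<le> r}" if "continuous_map X euclideanreal p" for p and r :: real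
    proof -
      have "closedin X {x \<in> topspace X. p x \<in> {..r}}"
        by (rule closedin_continuous_map_preimage[where Y = euclideanreal]) (auto intro!: that)
      then show ?thesis by simp
    qed
    define \<C> where "\<C> = insert (topspace X)
       ((\<lambda>(f, g). {x \<in> topspace X. x (\<lambda>a. f a + g a) = x f + x g}) ` (bcont A \<times> bcont A) \<union>
        (\<lambda>(f, k). {x \<in> topspace X. x (\<lambda>a. k * f a) = k * x f}) ` (bcont A \<times> UNIV) \<union>
        (\<lambda>(f, s, t). {x \<in> topspace X. x f \<le> s + t * l}) `
          {(f, s, t). f \<in> bcont A \<and> 0 \<le> t \<and> (\<forall>a\<in>A. f a \<le> s + t * \<phi> a)})"
    have "closedin X (\<Inter>\<C>)"
    proof (rule closedin_Inter)
      show "closedin X S" if "S \<in> \<C>" for S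
        using that unfolding \<C>_def
        by (auto intro!: eq le proj bcont_add bcont_cmult continuous_map_add continuous_map_real_mult_left)
    qed (simp add: \<C>_def)
    also have "\<Inter>\<C> = T"
    proof (rule set_eqI)
      fix x show "x \<in> \<Inter>\<C> \<longleftrightarrow> x \<in> T"
        unfolding \<C>_def T_def by (simp add: ball_Un split_paired_Ball_Sigma split_paired_all) blast
    qed
    finally show ?thesis .
  qed
  have e_C: "e ` C = T"
  proof (intro equalityI subsetI)
    fix x assume "x \<in> e ` C"
    then obtain M where M: "M \<in> borel_probs A" "ext_integral M \<phi> \<le> ereal l" "x = e M" by (auto simp: C_def)
    interpret prob_space M using M by (simp add: borel_probs_iff)
    have sp: "space M = A" using M(1) by (rule borel_probs_space)
    have int: "integrable M f" if "f \<in> bcont A" for f by (rule bcont_integrable[OF M(1) that])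
    have [measurable]: "\<phi> \<in> borel_measurable M" using meas by (simp add: borel_probs_measurable[OF M(1)])
    have nn: "(\<integral>\<^sup>+a. ennreal (\<phi> a + m) \<partial>M) \<le> ennreal (l + m)"
      using M(2) m sp prob_space_axioms by (subst ext_integral_le_iff_nn[symmetric]) auto
    have ge: "AE a in M. 0 \<le> \<phi> a + m"
      using m(3) sp by (intro AE_I2) (metis add.commute neg_le_iff_le add_uminus_conv_diff diff_ge_0_iff_ge minus_minus)
    have intphi: "integrable M (\<lambda>a. \<phi> a + m)"
      using nn ge by (intro integrableI_nonneg) (auto simp: less_top[symmetric] top_unique)
    then have int\<phi>: "integrable M \<phi>"
      using Bochner_Integration.integrable_diff[OF intphi integrable_const[of m]] by simp
    have "ennreal (\<integral>a. \<phi> a + m \<partial>M) \<le> ennreal (l + m)"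
      using nn by (simp add: nn_integral_eq_integral[OF intphi ge])
    then have "(\<integral>a. \<phi> a + m \<partial>M) \<le> l + m" using m(2) by (simp add: ennreal_le_iff)
    then have \<phi>_le: "(\<integral>a. \<phi> a \<partial>M) \<le> l"
      using int\<phi> by (simp add: prob_space)
    have "x f \<le> s + t * l" if "f \<in> bcont A" "0 \<le> t" "\<forall>a\<in>A. f a \<le> s + t * \<phi> a" for f s t
    proof -
      have "(\<integral>a. f a \<partial>M) \<le> (\<integral>a. s + t * \<phi> a \<partial>M)"
        using that int int\<phi> sp by (intro integral_mono) auto
      also have "\<dots> = s + t * (\<integral>a. \<phi> a \<partial>M)" using int\<phi> by (simp add: prob_space)
      also have "\<dots> \<le> s + t * l" using \<phi>_le that(2) by (simp add: mult_left_mono)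
      finally show ?thesis using that(1) by (simp add: M(3) e_def)
    qed
    then show "x \<in> T"
      unfolding T_def using M(3) int
      by (auto simp: e_def X_def bcont_add bcont_cmult)
  next
    fix x assume x: "x \<in> T"
    have x_add: "x (\<lambda>a. f a + g a) = x f + x g" if "f \<in> bcont A" "g \<in> bcont A" for f g
      using x that unfolding T_def by blast
    have x_cmult: "x (\<lambda>a. k * f a) = k * x f" if "f \<in> bcont A" for f k
      using x that unfolding T_def by blast
    have x_le: "x f \<le> s + t * l" if "f \<in> bcont A" "0 \<le> t" "\<And>a. a \<in> A \<Longrightarrow> f a \<le> s + t * \<phi> a" for f s t
      using x that unfolding T_def by blast
    have x_uminus: "x (\<lambda>a. - f a) = - x f" if "f \<in> bcont A" for f using x_cmult[OF that, of "-1"] by simp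
    have x_nonneg: "0 \<le> x f" if f: "f \<in> bcont A" "\<And>a. a \<in> A \<Longrightarrow> 0 \<le> f a" for f
    proof -
      have "x (\<lambda>a. - f a) \<le> 0"
        using x_le[of "\<lambda>a. - f a" 0 0] bcont_cmult[OF f(1), of "-1"] f(2) by auto
      then show ?thesis using x_uminus[OF f(1)] by simp
    qed
    interpret daniell_functional A x
    proof
      show "x (\<lambda>_. 1) = 1"
        using x_le[of "\<lambda>_. 1" 0 1] x_le[of "\<lambda>_. - 1" 0 "- 1"] x_uminus[of "\<lambda>_. 1"] by simp
    next
      fix F :: "nat \<Rightarrow> 'a \<Rightarrow> real"
      assume F: "\<And>n. F n \<in> bcont A" "\<And>a. a \<in> A \<Longrightarrow> decseq (\<lambda>n. F n a)"
        "\<And>a. a \<in> A \<Longrightarrow> (\<lambda>n. F n a) \<longlonglongrightarrow> 0"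
      have F0: "0 \<le> F n a" if "a \<in> A" for n a using decseq_ge[OF F(2,3)] that by blast
      obtain K where K: "0 \<le> K" "\<And>a. a \<in> A \<Longrightarrow> \<bar>F 0 a\<bar> \<le> K" using F(1)[of 0] by (metis bcontE)
      have FK: "F n a \<le> K" if "a \<in> A" for n a
        using K(2)[OF that] F(2)[OF that] unfolding decseq_def by (smt (verit) le0)
      have small: "\<exists>N. \<forall>n\<ge>N. x (F n) \<le> \<delta> + K * (l + m) / r" if "\<delta> > 0" "r > 0" for \<delta> r
      proof -
        define Q where "Q = {a \<in> A. ereal (\<phi> a) \<le> ereal (r - m)}"
        have "compact Q" using inf_compact unfolding Q_def inf_compact_on_def by blast
        have "\<forall>n. \<exists>U. open U \<and> A \<inter> U = {a \<in> A. F n a < \<delta>}"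
        proof
          fix n
          have "continuous_on A (F n)" using F(1) by (simp add: bcont_def)
          then have "openin (top_of_set A) (A \<inter> F n -` {..<\<delta>})"
            by (rule continuous_openin_preimage_gen) auto
          then show "\<exists>U. open U \<and> A \<inter> U = {a \<in> A. F n a < \<delta>}"
            unfolding openin_open by (auto simp: vimage_def Int_def)
        qed
        then obtain U where U: "\<And>n. open (U n)" "\<And>n. A \<inter> U n = {a \<in> A. F n a < \<delta>}" by metis
        have "Q \<subseteq> (\<Union>n\<in>UNIV. U n)"
        proof
          fix a assume "a \<in> Q"
          then have a: "a \<in> A" by (simp add: Q_def)
          then obtain n where "F n a < \<delta>"
            using order_tendstoD(2)[OF F(3)[OF a] \<open>\<delta> > 0\<close>] by (auto simp: eventually_sequentially)
          then show "a \<in> (\<Union>n\<in>UNIV. U n)" using U(2)[of n] a by blast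
        qed
        then obtain D where D: "finite D" "Q \<subseteq> (\<Union>n\<in>D. U n)"
          by (rule compactE_image[OF \<open>compact Q\<close> U(1)])
        \<comment> \<open>On the compact set \<open>Q\<close> the functions are eventually below \<open>\<delta>\<close> (Dini); off \<open>Q\<close> the function
          \<open>(\<phi> + m) / r\<close> is at least \<open>1\<close> and dominates after scaling by \<open>K\<close>.\<close>
        have small: "F n a \<le> \<delta> + K / r * m + K / r * \<phi> a" if "\<forall>d\<in>D. d \<le> n" "a \<in> A" for n a
        proof (cases "a \<in> Q")
          case True
          then obtain d where d: "d \<in> D" "a \<in> U d" using D(2) by blast
          then have "a \<in> {a \<in> A. F d a < \<delta>}" using \<open>a \<in> A\<close> unfolding U(2)[symmetric] by simp
          then have "F d a < \<delta>" by simp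
          moreover have "F n a \<le> F d a" using F(2)[OF \<open>a \<in> A\<close>] that(1) d(1) by (auto simp: decseq_def)
          moreover have "0 \<le> K / r * (m + \<phi> a)"
            using m(3)[OF \<open>a \<in> A\<close>] K \<open>r > 0\<close> by (intro mult_nonneg_nonneg) auto
          ultimately show ?thesis by (simp add: algebra_simps)
        next
          case False
          then have "r \<le> m + \<phi> a" using \<open>a \<in> A\<close> by (auto simp: Q_def)
          then have "K / r * r \<le> K / r * (m + \<phi> a)" using K \<open>r > 0\<close> by (intro mult_left_mono) auto
          then have "K \<le> K / r * m + K / r * \<phi> a" using \<open>r > 0\<close> by (simp add: distrib_left)
          then show ?thesis using FK[OF \<open>a \<in> A\<close>, of n] \<open>\<delta> > 0\<close> by linarith
        qed
        show ?thesis
        proof (intro exI[of _ "Max (insert 0 D)"] allI impI)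
          fix n assume "Max (insert 0 D) \<le> n"
          then have "\<forall>d\<in>D. d \<le> n" using D(1) by simp
          then have "x (F n) \<le> (\<delta> + K / r * m) + K / r * l"
            using K \<open>r > 0\<close> by (intro x_le F(1) small) auto
          then show "x (F n) \<le> \<delta> + K * (l + m) / r" by (simp add: algebra_simps add_divide_distrib)
        qed
      qed
      show "(\<lambda>n. x (F n)) \<longlonglongrightarrow> 0"
      proof (rule LIMSEQ_I)
        fix \<epsilon> :: real assume "\<epsilon> > 0"
        \<comment> \<open>Large enough that \<open>K * (l + m) / r < \<epsilon> / 2\<close>, and positive even if \<open>K * (l + m) = 0\<close>.\<close>
        define r where "r = (2 * K * (l + m) + 1) / \<epsilon>"
        have "0 \<le> K * (l + m)" using K m by simp
        then have "r > 0" "K * (l + m) / r < \<epsilon> / 2 + 0"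
          using \<open>\<epsilon> > 0\<close> unfolding r_def by (auto simp: field_simps intro: add_nonneg_pos)
        then obtain N where "\<forall>n\<ge>N. x (F n) \<le> \<epsilon> / 2 + K * (l + m) / r"
          using small[of "\<epsilon> / 2" r] \<open>\<epsilon> > 0\<close> by auto
        moreover have "0 \<le> x (F n)" for n using F(1) F0 by (intro x_nonneg) auto
        ultimately have "norm (x (F n) - 0) < \<epsilon>" if "N \<le> n" for n
          using \<open>K * (l + m) / r < \<epsilon> / 2 + 0\<close> that by (smt (verit) field_sum_of_halves real_norm_def)
        then show "\<exists>N. \<forall>n\<ge>N. norm (x (F n) - 0) < \<epsilon>" by blast
      qed
    qed (use x_add x_cmult x_nonneg in auto)
    obtain M where M: "M \<in> borel_probs A" "\<And>f. f \<in> bcont A \<Longrightarrow> (\<integral>a. f a \<partial>M) = x f"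
      using representing_measure by blast
    have "ext_integral M \<phi> \<le> ereal l"
      unfolding ext_integral_le_iff_bcont[OF M(1) lsc meas bdd]
      using M(2) x_le[of _ 1 0] by auto
    moreover have "x = e M"
      using x M(2) unfolding T_def X_def e_def by (auto simp: fun_eq_iff PiE_iff extensional_def restrict_def)
    ultimately show "x \<in> e ` C" using M(1) by (auto simp: C_def)
  qed
  have "compactin X T"
  proof -
    \<comment> \<open>A functional in \<open>T\<close> is bounded by the supremum norm, by the case \<open>t = 0\<close> of the schema.\<close>
    define R where "R f = {- Sup ((\<lambda>a. \<bar>f a\<bar>) ` A) .. Sup ((\<lambda>a. \<bar>f a\<bar>) ` A)}" for f :: "'a \<Rightarrow> real"
    have "compactin X (Pi\<^sub>E (bcont A) R)"
      unfolding X_def compactin_PiE R_def by auto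
    moreover have "T \<subseteq> Pi\<^sub>E (bcont A) R"
    proof
      fix x assume x: "x \<in> T"
      have "x f \<in> R f" if f: "f \<in> bcont A" for f
      proof -
        define s where "s = Sup ((\<lambda>a. \<bar>f a\<bar>) ` A)"
        obtain K where K: "\<And>a. a \<in> A \<Longrightarrow> \<bar>f a\<bar> \<le> K" using f by (metis bcontE)
        have s: "\<bar>f a\<bar> \<le> s" if "a \<in> A" for a
          unfolding s_def using that K by (intro cSUP_upper bdd_aboveI2[where M = K]) auto
        have le: "x h \<le> s + 0 * l" if "h \<in> bcont A" "\<And>a. a \<in> A \<Longrightarrow> h a \<le> s" for h
        proof -
          have "\<forall>a\<in>A. h a \<le> s + 0 * \<phi> a" using that(2) by simp
          then show ?thesis using x that(1) unfolding T_def by blast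
        qed
        have "f a \<le> s" "-1 * f a \<le> s" if "a \<in> A" for a using s[OF that] by auto
        then have "x f \<le> s + 0 * l" "x (\<lambda>a. -1 * f a) \<le> s + 0 * l"
          using le[OF f] le[OF bcont_cmult[OF f, of "-1"]] by blast+
        moreover have "x (\<lambda>a. -1 * f a) = -1 * x f" using x f unfolding T_def by blast
        ultimately show ?thesis unfolding R_def s_def by auto
      qed
      then show "x \<in> Pi\<^sub>E (bcont A) R" using x unfolding T_def X_def by (auto simp: PiE_iff)
    qed
    ultimately show ?thesis using closed_T by (rule closed_compactin)
  qed
  show "compactin (weak_topology A) C"
    unfolding compactin_def
  proof (intro conjI allI impI)
    show "C \<subseteq> topspace (weak_topology A)" by (auto simp: C_def topspace_weak_topology)
    fix \<U> assume \<U>: "Ball \<U> (openin (weak_topology A)) \<and> C \<subseteq> \<Union>\<U>"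
    then have "\<forall>V\<in>\<U>. \<exists>W. openin X W \<and> (\<forall>M. M \<in> V \<longleftrightarrow> M \<in> borel_probs A \<and> e M \<in> W)"
      unfolding X_def e_def by (intro ballI openin_weak_topology_evaluation) blast
    from bchoice[OF this] obtain W where
      W: "\<forall>V\<in>\<U>. openin X (W V) \<and> (\<forall>M. M \<in> V \<longleftrightarrow> M \<in> borel_probs A \<and> e M \<in> W V)" by (elim exE)
    have "T \<subseteq> \<Union> (W ` \<U>)"
    proof
      fix x assume "x \<in> T"
      then obtain M where M: "M \<in> C" "x = e M" using e_C by blast
      then obtain V where "V \<in> \<U>" "M \<in> V" using \<U> by blast
      then show "x \<in> \<Union> (W ` \<U>)" using W M(2) by blast
    qed
    moreover have "\<forall>S\<in>W ` \<U>. openin X S" using W by auto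
    ultimately obtain \<F> where "finite \<F>" "\<F> \<subseteq> W ` \<U>" "T \<subseteq> \<Union>\<F>"
      using \<open>compactin X T\<close> unfolding compactin_def by meson
    then obtain \<G> where \<G>: "\<G> \<subseteq> \<U>" "finite \<G>" "T \<subseteq> \<Union> (W ` \<G>)" by (metis finite_subset_image)
    have "C \<subseteq> \<Union>\<G>"
    proof
      fix M assume M: "M \<in> C"
      then have "e M \<in> T" using e_C by blast
      then obtain V where "V \<in> \<G>" "e M \<in> W V" using \<G>(3) by blast
      moreover have "M \<in> borel_probs A" using M by (simp add: C_def)
      ultimately show "M \<in> \<Union>\<G>"
        using W \<G>(1) by blast
    qed
    then show "\<exists>\<F>. finite \<F> \<and> \<F> \<subseteq> \<U> \<and> C \<subseteq> \<Union>\<F>" using \<G> by blast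
  qed
qed

text \<open>By \<open>ext_integral_le_iff_bcont\<close> the set is an intersection of basic closed sets.\<close>
lemma closedin_ext_integral_sublevel:
  fixes \<phi> :: "'a::metric_space \<Rightarrow> real"
  assumes lsc: "lsc_on A (\<lambda>a. ereal (\<phi> a))"
    and meas: "\<phi> \<in> borel_measurable (restrict_space borel A)"
    and bdd: "bdd_below (\<phi> ` A)"
  shows "closedin (weak_topology A) {M \<in> borel_probs A. ext_integral M \<phi> \<le> ereal l}"
proof -
  have basic: "closedin (weak_topology A) {M \<in> borel_probs A. (\<integral>a. f a \<partial>M) \<le> l}" if "f \<in> bcont A" for f
  proof -
    have "openin (weak_topology A) {M \<in> borel_probs A. (\<integral>a. f a \<partial>M) \<in> {l<..}}"
      unfolding weak_topology_def
    proof (rule topology_generated_by_Basis, intro CollectI exI conjI)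
      show "continuous_on A f" "bounded (f ` A)" using that by (auto simp: bcont_def)
      show "open {l<..}" by simp
    qed simp
    moreover have "borel_probs A - {M \<in> borel_probs A. (\<integral>a. f a \<partial>M) \<le> l} = {M \<in> borel_probs A. (\<integral>a. f a \<partial>M) \<in> {l<..}}"
      by auto
    ultimately show ?thesis unfolding closedin_def topspace_weak_topology by auto
  qed
  have "{M \<in> borel_probs A. ext_integral M \<phi> \<le> ereal l} =
      \<Inter> (insert (borel_probs A) ((\<lambda>f. {M \<in> borel_probs A. (\<integral>a. f a \<partial>M) \<le> l}) ` {f \<in> bcont A. \<forall>a\<in>A. f a \<le> \<phi> a}))"
    using ext_integral_le_iff_bcont[OF _ lsc meas bdd] by auto
  also have "closedin (weak_topology A) \<dots>"
    using basic closedin_topspace[of "weak_topology A"] by (intro closedin_Inter) (auto simp: topspace_weak_topology)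
  finally show ?thesis .
qed

section \<open>Mixtures, Dirac measures and finitely supported measures\<close>

lemma nn_integral_mixture:
  assumes N: "sets N = sets M" and f: "f \<in> borel_measurable M"
  shows "(\<integral>\<^sup>+x. f x \<partial>mixture t M N) = ennreal t * (\<integral>\<^sup>+x. f x \<partial>M) + ennreal (1 - t) * (\<integral>\<^sup>+x. f x \<partial>N)"
  using f
proof (induction rule: borel_measurable_induct)
  case (cong f g)
  have sp: "space (mixture t M N) = space M" "space N = space M"
    using N by (intro sets_eq_imp_space_eq; simp)+
  have "(\<integral>\<^sup>+x. f x \<partial>mixture t M N) = (\<integral>\<^sup>+x. g x \<partial>mixture t M N)"
    by (rule nn_integral_cong) (use cong sp in simp)
  moreover have "(\<integral>\<^sup>+x. f x \<partial>M) = (\<integral>\<^sup>+x. g x \<partial>M)"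
    by (rule nn_integral_cong) (use cong in simp)
  moreover have "(\<integral>\<^sup>+x. f x \<partial>N) = (\<integral>\<^sup>+x. g x \<partial>N)"
    by (rule nn_integral_cong) (use cong sp in simp)
  ultimately show ?case using cong by simp
next
  case (set S)
  then show ?case using N by (simp add: emeasure_mixture)
next
  case (mult u k)
  have u: "u \<in> borel_measurable N" "u \<in> borel_measurable (mixture t M N)"
    using mult N by (auto cong: measurable_cong_sets)
  show ?case using mult u by (simp add: nn_integral_cmult distrib_left mult_ac)
next
  case (add u v)
  have "u \<in> borel_measurable N" "u \<in> borel_measurable (mixture t M N)"
    "v \<in> borel_measurable N" "v \<in> borel_measurable (mixture t M N)"
    using add N by (auto cong: measurable_cong_sets)
  then show ?case using add by (simp add: nn_integral_add distrib_left add_ac)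
next
  case (seq U)
  have U: "U i \<in> borel_measurable N" "U i \<in> borel_measurable (mixture t M N)" for i
    using seq N by (auto cong: measurable_cong_sets)
  have sup: "(\<integral>\<^sup>+x. (SUP i. U i) x \<partial>K) = (SUP i. \<integral>\<^sup>+x. U i x \<partial>K)"
    if "\<And>i. U i \<in> borel_measurable K" for K
    using nn_integral_monotone_convergence_SUP[OF seq(3) that] by (simp add: image_image SUP_apply)
  have inc: "incseq (\<lambda>i. ennreal r * (\<integral>\<^sup>+x. U i x \<partial>K))" for r K
    using seq(3) by (auto simp: incseq_def le_fun_def intro!: mult_left_mono nn_integral_mono)
  have "(\<integral>\<^sup>+x. (SUP i. U i) x \<partial>mixture t M N) =
      (SUP i. ennreal t * (\<integral>\<^sup>+x. U i x \<partial>M) + ennreal (1 - t) * (\<integral>\<^sup>+x. U i x \<partial>N))"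
    unfolding sup[OF U(2)] seq.IH ..
  also have "\<dots> = (SUP i. ennreal t * (\<integral>\<^sup>+x. U i x \<partial>M)) + (SUP i. ennreal (1 - t) * (\<integral>\<^sup>+x. U i x \<partial>N))"
    by (rule ennreal_SUP_add[OF inc inc])
  also have "\<dots> = ennreal t * (SUP i. \<integral>\<^sup>+x. U i x \<partial>M) + ennreal (1 - t) * (SUP i. \<integral>\<^sup>+x. U i x \<partial>N)"
    by (simp add: SUP_mult_left_ennreal)
  finally show ?case unfolding sup[OF U(1)] sup[OF seq(1)] .
qed

lemma mixture_borel_probs:
  assumes "M \<in> borel_probs A" "N \<in> borel_probs A" "t \<in> {0..1}"
  shows "mixture t M N \<in> borel_probs A"
proof -
  interpret M: prob_space M using assms by (simp add: borel_probs_iff)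
  interpret N: prob_space N using assms by (simp add: borel_probs_iff)
  have sets: "sets N = sets M" "space N = space M" "space (mixture t M N) = space M"
    using assms borel_probs_space by (auto simp: borel_probs_iff intro!: sets_eq_imp_space_eq)
  have "emeasure (mixture t M N) (space (mixture t M N)) = 1"
    using assms(3) M.emeasure_space_1 N.emeasure_space_1 unfolding sets(3)
    by (subst emeasure_mixture) (auto simp: sets ennreal_plus[symmetric] simp del: ennreal_plus)
  then have "prob_space (mixture t M N)" by (rule prob_spaceI)
  then show ?thesis using assms(1) by (simp add: borel_probs_iff)
qed

lemma integral_mixture:
  assumes N: "sets N = sets M" and f: "integrable M f" "integrable N f" and t: "t \<in> {0..1}"
  shows "integrable (mixture t M N) f"
    and "(\<integral>x. f x \<partial>mixture t M N) = t * (\<integral>x. f x \<partial>M) + (1 - t) * (\<integral>x. f x \<partial>N :: real)"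
proof -
  have [measurable]: "f \<in> borel_measurable M" using f by auto
  have fin: "(\<integral>\<^sup>+x. ennreal (f x) \<partial>M) \<noteq> \<infinity>" "(\<integral>\<^sup>+x. ennreal (- f x) \<partial>M) \<noteq> \<infinity>"
     "(\<integral>\<^sup>+x. ennreal (f x) \<partial>N) \<noteq> \<infinity>" "(\<integral>\<^sup>+x. ennreal (- f x) \<partial>N) \<noteq> \<infinity>"
    using f by (auto simp: real_integrable_def)
  have mix: "(\<integral>\<^sup>+x. ennreal (g x) \<partial>mixture t M N) =
      ennreal t * (\<integral>\<^sup>+x. ennreal (g x) \<partial>M) + ennreal (1 - t) * (\<integral>\<^sup>+x. ennreal (g x) \<partial>N)"
    if "g \<in> borel_measurable M" for g
    using that N by (intro nn_integral_mixture) auto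
  show int: "integrable (mixture t M N) f"
    unfolding real_integrable_def using fin
    by (auto simp: mix ennreal_mult_eq_top_iff cong: measurable_cong_sets)
  have e2r: "enn2real (ennreal t * a + ennreal (1 - t) * b) = t * enn2real a + (1 - t) * enn2real b"
    if "a \<noteq> \<infinity>" "b \<noteq> \<infinity>" for a b
    using that t by (cases a; cases b)
      (auto simp: ennreal_mult[symmetric] ennreal_plus[symmetric] simp del: ennreal_plus)
  show "(\<integral>x. f x \<partial>mixture t M N) = t * (\<integral>x. f x \<partial>M) + (1 - t) * (\<integral>x. f x \<partial>N)"
    using fin by (simp add: real_lebesgue_integral_def int f mix e2r right_diff_distrib)
qed

text \<open>The measure \<open>\<Sum>b\<in>I. w b \<cdot> \<delta>\<^sub>b\<close>, described by its integrals.\<close>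
lemma finitely_supported_strategy:
  fixes B :: "'b::topological_space set" and w :: "'b \<Rightarrow> real"
  assumes I: "finite I" "I \<subseteq> B" and w: "\<And>b. b \<in> I \<Longrightarrow> 0 \<le> w b" "sum w I = 1"
  obtains N where "N \<in> borel_probs B"
    "\<And>h. h \<in> borel_measurable (restrict_space borel B) \<Longrightarrow> (\<integral>\<^sup>+b. h b \<partial>N) = (\<Sum>b\<in>I. ennreal (w b) * h b)"
proof -
  define N0 where "N0 = point_measure I (\<lambda>b. ennreal (w b))"
  define N where "N = distr N0 (restrict_space borel B) (\<lambda>b. b)"
  have meas: "(\<lambda>b. b) \<in> measurable N0 (restrict_space borel B)"
    using I unfolding N0_def by (auto simp: space_restrict_space)
  have "emeasure N0 (space N0) = 1"
    using I w unfolding N0_def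
    by (simp add: space_point_measure emeasure_point_measure_finite sum_ennreal)
  then have "prob_space N0" by (rule prob_spaceI)
  then have "prob_space N" unfolding N_def using meas by (rule prob_space.prob_space_distr)
  then have "N \<in> borel_probs B" by (simp add: borel_probs_iff N_def)
  moreover have "(\<integral>\<^sup>+b. h b \<partial>N) = (\<Sum>b\<in>I. ennreal (w b) * h b)"
    if "h \<in> borel_measurable (restrict_space borel B)" for h
    using I that unfolding N_def
    by (subst nn_integral_distr[OF meas]) (auto simp: N0_def nn_integral_point_measure_finite)
  ultimately show thesis by (rule that)
qed

lemma dirac_on_borel_probs: "s \<in> S \<Longrightarrow> dirac_on S s \<in> borel_probs S"
  by (auto simp: borel_probs_iff dirac_on_def space_restrict_space intro!: prob_space_return)

lemma nn_integral_dirac_on: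
  "s \<in> S \<Longrightarrow> h \<in> borel_measurable (restrict_space borel S) \<Longrightarrow> (\<integral>\<^sup>+x. h x \<partial>dirac_on S s) = h s"
  by (simp add: dirac_on_def nn_integral_return space_restrict_space)

lemma ennreal_max_0: "ennreal (max x 0) = ennreal x"
  by (simp add: max_def ennreal_neg)

lemma ennreal_minus_min_0: "ennreal (- min x 0) = ennreal (- x)"
  by (simp add: min_def ennreal_neg)

lemma ext_integral_dirac_on:
  assumes "s \<in> S" "\<phi> \<in> borel_measurable (restrict_space borel S)"
  shows "ext_integral (dirac_on S s) \<phi> = ereal (\<phi> s)"
  using assms by (cases "0 \<le> \<phi> s") (simp_all add: ext_integral_def nn_integral_dirac_on ennreal_neg zero_ennreal.rep_eq)

section \<open>A finite minimax principle\<close>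

text \<open>A theorem of the alternative for convexlike families of functions: if no \<open>x\<close> makes all \<open>f x i\<close>
negative, some convex combination of the coordinates is nonnegative for every \<open>x\<close>. The induction on the index
set reduces it to two coordinates. By the induction hypothesis, applied to those \<open>x\<close> with \<open>f x k < 0\<close>,
the remaining coordinates can be replaced by one combination \<open>g\<close> such that \<open>f x k\<close> and \<open>g x\<close> are never
both negative; a line separating the points that dominate some \<open>(f x k, g x)\<close> from the open negative
quadrant supplies the final weights.\<close>
lemma convexlike_alternative:
  fixes f :: "'x \<Rightarrow> 'i \<Rightarrow> real"
  assumes "finite I" "I \<noteq> {}"
    and "\<And>x y t. x \<in> P \<Longrightarrow> y \<in> P \<Longrightarrow> t \<in> {0..1} \<Longrightarrow> \<exists>z\<in>P. \<forall>i\<in>I. f z i \<le> t * f x i + (1 - t) * f y i"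
    and "\<And>x. x \<in> P \<Longrightarrow> \<exists>i\<in>I. 0 \<le> f x i"
  shows "\<exists>w. (\<forall>i\<in>I. 0 \<le> w i) \<and> sum w I = 1 \<and> (\<forall>x\<in>P. 0 \<le> (\<Sum>i\<in>I. w i * f x i))"
  using assms
proof (induction I arbitrary: P rule: finite_ne_induct)
  case (singleton k)
  then show ?case by (intro exI[of _ "\<lambda>_. 1"]) auto
next
  case (insert k J)
  define P0 where "P0 = {x \<in> P. f x k < 0}"
  have "\<exists>u. (\<forall>i\<in>J. 0 \<le> u i) \<and> sum u J = 1 \<and> (\<forall>x\<in>P0. 0 \<le> (\<Sum>i\<in>J. u i * f x i))"
  proof (rule insert.IH)
    fix x y t assume xy: "x \<in> P0" "y \<in> P0" "t \<in> {0..1::real}"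
    then obtain z where z: "z \<in> P" "\<forall>i\<in>insert k J. f z i \<le> t * f x i + (1 - t) * f y i"
      using insert.prems(1)[of x y t] unfolding P0_def by auto
    have "t * f x k + (1 - t) * f y k < 0"
    proof (cases "t = 0")
      case False
      then have "t * f x k < 0" "(1 - t) * f y k \<le> 0"
        using xy by (auto simp: P0_def mult_less_0_iff mult_le_0_iff)
      then show ?thesis by linarith
    qed (use xy in \<open>simp add: P0_def\<close>)
    moreover have "f z k \<le> t * f x k + (1 - t) * f y k" using z(2) by simp
    ultimately have "z \<in> P0" using z(1) unfolding P0_def by simp
    then show "\<exists>z\<in>P0. \<forall>i\<in>J. f z i \<le> t * f x i + (1 - t) * f y i" using z(2) by auto
  next
    fix x assume "x \<in> P0"
    then show "\<exists>i\<in>J. 0 \<le> f x i" using insert.prems(2)[of x] unfolding P0_def by auto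
  qed
  then obtain u where u: "\<And>i. i \<in> J \<Longrightarrow> 0 \<le> u i" "sum u J = 1" "\<And>x. x \<in> P0 \<Longrightarrow> 0 \<le> (\<Sum>i\<in>J. u i * f x i)"
    by blast
  define g where "g x = (\<Sum>i\<in>J. u i * f x i)" for x
  have alt: "0 \<le> f x k \<or> 0 \<le> g x" if "x \<in> P" for x
    using u(3)[of x] that unfolding P0_def g_def by force
  have "\<exists>p q. 0 \<le> p \<and> 0 \<le> q \<and> p + q > 0 \<and> (\<forall>x\<in>P. 0 \<le> p * f x k + q * g x)"
  proof (cases "P = {}")
    case True
    then show ?thesis by (intro exI[of _ 1] exI[of _ 0]) auto
  next
    case False
    define C where "C = {(r, s). \<exists>x\<in>P. f x k \<le> r \<and> g x \<le> s}"
    define Q where "Q = {(r, s). r < (0::real) \<and> s < (0::real)}"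
    have "convex C"
      unfolding convex_alt
    proof (intro ballI allI impI)
      fix v w :: "real \<times> real" and t :: real assume vw: "v \<in> C" "w \<in> C" and t: "0 \<le> t \<and> t \<le> 1"
      obtain r s x r' s' y where v: "v = (r, s)" "x \<in> P" "f x k \<le> r" "g x \<le> s"
        and w: "w = (r', s')" "y \<in> P" "f y k \<le> r'" "g y \<le> s'"
        using vw unfolding C_def by blast
      obtain z where z: "z \<in> P" "\<forall>i\<in>insert k J. f z i \<le> (1 - t) * f x i + (1 - (1 - t)) * f y i"
        using insert.prems(1)[OF v(2) w(2), of "1 - t"] t by auto
      have "g z \<le> (\<Sum>i\<in>J. u i * ((1 - t) * f x i + t * f y i))"
        unfolding g_def using z(2) u(1) by (intro sum_mono mult_left_mono) auto
      also have "\<dots> = (1 - t) * g x + t * g y"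
        unfolding g_def by (simp add: sum_distrib_left sum.distrib distrib_left mult.left_commute)
      also have "\<dots> \<le> (1 - t) * s + t * s'"
        using v w t by (intro add_mono mult_left_mono) auto
      finally have "g z \<le> (1 - t) * s + t * s'" .
      moreover have "f z k \<le> (1 - t) * r + t * r'"
      proof -
        have "f z k \<le> (1 - t) * f x k + t * f y k" using z(2) by auto
        also have "\<dots> \<le> (1 - t) * r + t * r'"
          using v w t by (intro add_mono mult_left_mono) auto
        finally show ?thesis .
      qed
      ultimately show "(1 - t) *\<^sub>R v + t *\<^sub>R w \<in> C" using z(1) unfolding C_def v(1) w(1) by auto
    qed
    moreover have "convex Q"
    proof -
      have "Q = {..<0} \<times> {..<0}" unfolding Q_def by auto
      then show ?thesis by (simp add: convex_Times)
    qed
    moreover have "C \<noteq> {}" using False unfolding C_def by blast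
    moreover have "Q \<noteq> {}"
    proof -
      have "(-1, -1) \<in> Q" unfolding Q_def by simp
      then show ?thesis by blast
    qed
    moreover have "Q \<inter> C = {}" using alt unfolding C_def Q_def by fastforce
    ultimately obtain v b where vb: "v \<noteq> 0" "\<forall>x\<in>Q. inner v x \<le> b" "\<forall>x\<in>C. inner v x \<ge> b"
      using separating_hyperplane_sets[of Q C] by blast
    obtain p q where v: "v = (p, q)" by (cases v)
    have Q: "p * r + q * s \<le> b" if "r < 0" "s < 0" for r s
      using vb(2) that unfolding Q_def v by auto
    have C: "b \<le> p * f x k + q * g x" if "x \<in> P" for x
      using vb(3) that unfolding C_def v by auto
    have "0 \<le> b"
    proof (rule field_le_epsilon)
      fix e :: real assume "e > 0"
      define d where "d = e / (\<bar>p\<bar> + \<bar>q\<bar> + 1)"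
      have d: "d > 0" "d * (\<bar>p\<bar> + \<bar>q\<bar> + 1) = e" using \<open>e > 0\<close> unfolding d_def by auto
      have "d * p \<le> d * \<bar>p\<bar>" "d * q \<le> d * \<bar>q\<bar>" using d(1) by auto
      then have "d * p + d * q \<le> e" using d unfolding distrib_left mult_1_right by linarith
      then show "0 \<le> b + e" using Q[of "- d" "- d"] d(1) by (simp add: algebra_simps)
    qed
    have "0 \<le> p"
    proof (rule ccontr)
      assume "\<not> 0 \<le> p"
      then have "p * ((b + \<bar>q\<bar> + 1) / p) + q * -1 \<le> b"
        using \<open>0 \<le> b\<close> by (intro Q) (auto simp: divide_less_0_iff)
      then show False using \<open>\<not> 0 \<le> p\<close> by auto
    qed
    moreover have "0 \<le> q"
    proof (rule ccontr)
      assume "\<not> 0 \<le> q"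
      then have "p * -1 + q * ((b + \<bar>p\<bar> + 1) / q) \<le> b"
        using \<open>0 \<le> b\<close> by (intro Q) (auto simp: divide_less_0_iff)
      then show False using \<open>\<not> 0 \<le> q\<close> by auto
    qed
    moreover have "p \<noteq> 0 \<or> q \<noteq> 0" using vb(1) v by (auto simp: zero_prod_def)
    ultimately show ?thesis using C \<open>0 \<le> b\<close> by (intro exI[of _ p] exI[of _ q]) force
  qed
  then obtain p q where pq: "0 \<le> p" "0 \<le> q" "p + q > 0" "\<And>x. x \<in> P \<Longrightarrow> 0 \<le> p * f x k + q * g x" by blast
  define w where "w i = (if i = k then p else q * u i) / (p + q)" for i
  have sum_J: "(\<Sum>i\<in>J. w i * h i) = q * (\<Sum>i\<in>J. u i * h i) / (p + q)" for h
  proof -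
    have "(\<Sum>i\<in>J. w i * h i) = (\<Sum>i\<in>J. q * (u i * h i) / (p + q))"
      using insert.hyps by (intro sum.cong) (auto simp: w_def)
    then show ?thesis by (simp add: sum_distrib_left sum_divide_distrib)
  qed
  show ?case
  proof (intro exI[of _ w] conjI ballI)
    show "0 \<le> w i" if "i \<in> insert k J" for i using that pq u(1) by (auto simp: w_def)
    have "sum w J = q / (p + q)" using sum_J[of "\<lambda>_. 1"] u(2) by simp
    then show "sum w (insert k J) = 1"
      using insert.hyps pq(3) by (simp add: w_def add_divide_distrib[symmetric])
    fix x assume "x \<in> P"
    have "(\<Sum>i\<in>insert k J. w i * f x i) = (p * f x k + q * g x) / (p + q)"
      using insert.hyps sum_J[of "f x"] by (simp add: w_def g_def add_divide_distrib)
    then show "0 \<le> (\<Sum>i\<in>insert k J. w i * f x i)" using pq(3) pq(4)[OF \<open>x \<in> P\<close>] by simp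
  qed
qed

section \<open>Payoffs, the dual game and weak duality\<close>

locale zsgame =
  fixes A :: "'a::polish_space set" and B :: "'b::polish_space set" and c :: "'a \<times> 'b \<Rightarrow> real"
  assumes game: "zero_sum_game A B c"
begin

lemma bdd_below_c: "b \<in> B \<Longrightarrow> bdd_below ((\<lambda>a. c (a, b)) ` A)"
  using game by (simp add: zero_sum_game_def)

lemma bdd_above_c: "a \<in> A \<Longrightarrow> bdd_above ((\<lambda>b. c (a, b)) ` B)"
  using game by (simp add: zero_sum_game_def)

lemma B_ne: "B \<noteq> {}"
  using game by (simp add: zero_sum_game_def)

lemma c_measurable_pair:
  "c \<in> borel_measurable (restrict_space borel A \<Otimes>\<^sub>M restrict_space borel B)"
proof -
  let ?P = "restrict_space borel A \<Otimes>\<^sub>M restrict_space borel B"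
  have "(\<lambda>p. (fst p, snd p)) \<in> measurable ?P (borel \<Otimes>\<^sub>M borel)"
  proof (rule measurable_Pair)
    show "fst \<in> measurable ?P borel"
      by (rule measurable_compose[OF measurable_fst measurable_restrict_space1]) simp
    show "snd \<in> measurable ?P borel"
      by (rule measurable_compose[OF measurable_snd measurable_restrict_space1]) simp
  qed
  then have "(\<lambda>p. p) \<in> measurable ?P (restrict_space borel (A \<times> B))"
    by (intro measurable_restrict_space2) (auto simp: borel_prod space_pair_measure space_restrict_space)
  then show ?thesis
    using game unfolding zero_sum_game_def by (auto intro: measurable_compose)
qed

lemma c_measurable_I: "b \<in> B \<Longrightarrow> (\<lambda>a. c (a, b)) \<in> borel_measurable (restrict_space borel A)"
  by (rule measurable_compose[OF measurable_Pair2' c_measurable_pair]) (simp add: space_restrict_space)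

lemma c_measurable_II: "a \<in> A \<Longrightarrow> (\<lambda>b. c (a, b)) \<in> borel_measurable (restrict_space borel B)"
  by (rule measurable_compose[OF measurable_Pair1' c_measurable_pair]) (simp add: space_restrict_space)

lemma c_measurable_prod:
  assumes "M \<in> borel_probs A" "N \<in> borel_probs B"
  shows "c \<in> borel_measurable (M \<Otimes>\<^sub>M N)"
proof -
  have "sets (M \<Otimes>\<^sub>M N) = sets (restrict_space borel A \<Otimes>\<^sub>M restrict_space borel B)"
    using assms by (intro sets_pair_measure_cong) (auto simp: borel_probs_iff)
  then show ?thesis using c_measurable_pair by (simp cong: measurable_cong_sets)
qed

lemma payoff_dirac_II:
  assumes M: "M \<in> borel_probs A" and b: "b \<in> B"
  shows "payoff c M (dirac_on B b) = ext_integral M (\<lambda>a. c (a, b))"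
proof -
  have "(\<integral>\<^sup>+a. (\<integral>\<^sup>+y. ennreal (c (a, y)) \<partial>dirac_on B b) \<partial>M) = (\<integral>\<^sup>+a. ennreal (c (a, b)) \<partial>M)"
    "(\<integral>\<^sup>+a. (\<integral>\<^sup>+y. ennreal (- c (a, y)) \<partial>dirac_on B b) \<partial>M) = (\<integral>\<^sup>+a. ennreal (- c (a, b)) \<partial>M)"
    using b c_measurable_II borel_probs_space[OF M] by (auto intro!: nn_integral_cong simp: nn_integral_dirac_on)
  then show ?thesis
    by (simp add: payoff_def payoff_pos_def payoff_neg_def ext_integral_def ennreal_max_0 ennreal_minus_min_0 minus_ereal_def)
qed

lemma payoff_dirac_I:
  assumes N: "N \<in> borel_probs B" and a: "a \<in> A"
  shows "payoff c (dirac_on A a) N = ext_integral N (\<lambda>b. c (a, b))"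
proof -
  have N': "prob_space N" "sets N = sets (restrict_space borel B)" using N by (auto simp: borel_probs_iff)
  interpret prob_space N by fact
  have sets: "sets (restrict_space borel A \<Otimes>\<^sub>M restrict_space borel B) = sets (restrict_space borel A \<Otimes>\<^sub>M N)"
    using N' by (intro sets_pair_measure_cong) auto
  have [measurable]: "c \<in> borel_measurable (restrict_space borel A \<Otimes>\<^sub>M N)"
    using c_measurable_pair by (simp add: measurable_cong_sets[OF sets refl])
  have "(\<integral>\<^sup>+x. (\<integral>\<^sup>+b. ennreal (c (x, b)) \<partial>N) \<partial>dirac_on A a) = (\<integral>\<^sup>+b. ennreal (c (a, b)) \<partial>N)"
    "(\<integral>\<^sup>+x. (\<integral>\<^sup>+b. ennreal (- c (x, b)) \<partial>N) \<partial>dirac_on A a) = (\<integral>\<^sup>+b. ennreal (- c (a, b)) \<partial>N)"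
    using a by (simp_all add: nn_integral_dirac_on)
  then show ?thesis
    by (simp add: payoff_def payoff_pos_def payoff_neg_def ext_integral_def ennreal_max_0 ennreal_minus_min_0 minus_ereal_def)
qed

lemma payoff_sharp_eq:
  "M \<in> borel_probs A \<Longrightarrow> payoff_sharp B c M = (SUP b\<in>B. ext_integral M (\<lambda>a. c (a, b)))"
  unfolding payoff_sharp_def by (intro SUP_cong refl payoff_dirac_II)

lemma payoff_flat_eq:
  "N \<in> borel_probs B \<Longrightarrow> payoff_flat A c N = (INF a\<in>A. ext_integral N (\<lambda>b. c (a, b)))"
  unfolding payoff_flat_def by (intro INF_cong refl payoff_dirac_I)

text \<open>The bound \<open>z \<le> \<integral>c(a, \<cdot>) dN\<close> is integrated over \<open>a\<close>. To do so without subtracting infinities,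
the negative part of \<open>c\<close> is moved to the other side of the inequality, where both sides are integrals
of nonnegative functions; definedness of the payoff allows it to be moved back.\<close>
lemma payoff_flat_le_payoff:
  assumes M: "M \<in> borel_probs A" and N: "N \<in> borel_probs B" and def: "payoff_defined c M N"
  shows "payoff_flat A c N \<le> payoff c M N"
proof (rule dense_le)
  fix z assume z: "z < payoff_flat A c N"
  interpret M: prob_space M using M by (simp add: borel_probs_iff)
  interpret N: prob_space N using N by (simp add: borel_probs_iff)
  have [measurable]: "c \<in> borel_measurable (M \<Otimes>\<^sub>M N)" using M N by (rule c_measurable_prod)
  define P where "P a = (\<integral>\<^sup>+b. ennreal (c (a, b)) \<partial>N)" for a
  define Q where "Q a = (\<integral>\<^sup>+b. ennreal (- c (a, b)) \<partial>N)" for a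
  have [measurable]: "P \<in> borel_measurable M" "Q \<in> borel_measurable M"
    unfolding P_def Q_def by measurable
  have payoff: "payoff c M N = enn2ereal (\<integral>\<^sup>+a. P a \<partial>M) - enn2ereal (\<integral>\<^sup>+a. Q a \<partial>M)"
    by (simp add: payoff_def payoff_pos_def payoff_neg_def ennreal_max_0 ennreal_minus_min_0 minus_ereal_def P_def Q_def)
  have fin: "(\<integral>\<^sup>+a. P a \<partial>M) < top \<or> (\<integral>\<^sup>+a. Q a \<partial>M) < top"
    using def by (cases "\<integral>\<^sup>+a. P a \<partial>M"; cases "\<integral>\<^sup>+a. Q a \<partial>M")
      (auto simp: payoff_defined_def payoff_pos_def payoff_neg_def ennreal_max_0 ennreal_minus_min_0 P_def Q_def)
  show "z \<le> payoff c M N"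
  proof (cases z)
    case (real r)
    have "Q a + ennreal r \<le> P a + ennreal (- r)" if a: "a \<in> space M" for a
    proof -
      have "a \<in> A" using a borel_probs_space[OF M] by simp
      then have "payoff_flat A c N \<le> ext_integral N (\<lambda>b. c (a, b))"
        unfolding payoff_flat_eq[OF N] by (rule INF_lower)
      then have r: "ereal r \<le> enn2ereal (P a) - enn2ereal (Q a)"
        using z real by (simp add: ext_integral_def P_def Q_def)
      obtain k where k: "\<And>b. b \<in> B \<Longrightarrow> c (a, b) \<le> k"
        using bdd_above_c[OF \<open>a \<in> A\<close>] by (auto simp: bdd_above_def)
      have "P a \<le> (\<integral>\<^sup>+b. ennreal k \<partial>N)"
        unfolding P_def using k borel_probs_space[OF N] by (intro nn_integral_mono ennreal_leI) auto
      then have "P a \<le> ennreal k" by (simp add: N.emeasure_space_1)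
      then obtain p where p: "P a = ennreal p" "p \<ge> 0" by (cases "P a") (auto simp: top_unique)
      then obtain q where q: "Q a = ennreal q" "q \<ge> 0" using r by (cases "Q a") auto
      have "r \<le> p - q" using r p q by simp
      then show ?thesis
        using p q by (cases "0 \<le> r") (auto simp: ennreal_neg ennreal_plus[symmetric] simp del: ennreal_plus)
    qed
    then have "(\<integral>\<^sup>+a. Q a + ennreal r \<partial>M) \<le> (\<integral>\<^sup>+a. P a + ennreal (- r) \<partial>M)" by (rule nn_integral_mono)
    then have "(\<integral>\<^sup>+a. Q a \<partial>M) + ennreal r \<le> (\<integral>\<^sup>+a. P a \<partial>M) + ennreal (- r)"
      by (simp add: nn_integral_add M.emeasure_space_1)
    then show ?thesis
      using fin unfolding payoff real
      by (cases "\<integral>\<^sup>+a. P a \<partial>M"; cases "\<integral>\<^sup>+a. Q a \<partial>M"; cases "0 \<le> r")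
         (auto simp: ennreal_neg ennreal_plus[symmetric] top_unique simp del: ennreal_plus)
  qed (use z in auto)
qed

text \<open>The players are exchanged: Player II of the original game becomes the minimizing player.\<close>
definition dual :: "'b \<times> 'a \<Rightarrow> real" where
  "dual p = - c (snd p, fst p)"

lemma dual_game: "zero_sum_game B A dual"
proof -
  have "(\<lambda>p. (snd p, fst p)) \<in> measurable (restrict_space borel (B \<times> A)) borel"
    by (intro borel_measurable_continuous_on_restrict continuous_intros)
  then have "(\<lambda>p. (snd p, fst p)) \<in> measurable (restrict_space borel (B \<times> A)) (restrict_space borel (A \<times> B))"
    by (intro measurable_restrict_space2) (auto simp: space_restrict_space)
  then have "(\<lambda>p. c (snd p, fst p)) \<in> borel_measurable (restrict_space borel (B \<times> A))"
    using game unfolding zero_sum_game_def by (auto intro: measurable_compose)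
  then have "dual \<in> borel_measurable (restrict_space borel (B \<times> A))"
    unfolding dual_def by measurable
  moreover have "bdd_below ((\<lambda>b. dual (b, a)) ` B)" if "a \<in> A" for a
    using bdd_above_c[OF that] by (auto simp: bdd_above_def bdd_below_def dual_def) (metis neg_le_iff_le)
  moreover have "bdd_above ((\<lambda>a. dual (b, a)) ` A)" if "b \<in> B" for b
    using bdd_below_c[OF that] by (auto simp: bdd_above_def bdd_below_def dual_def) (metis neg_le_iff_le)
  ultimately show ?thesis using game by (simp add: zero_sum_game_def)
qed

text \<open>The iterated integrals in the two games run in opposite orders; Tonelli's theorem exchanges them.\<close>
lemma payoff_dual_parts:
  assumes M: "M \<in> borel_probs A" and N: "N \<in> borel_probs B"
  shows "payoff_pos dual N M = - payoff_neg c M N" "payoff_neg dual N M = - payoff_pos c M N"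
proof -
  interpret M: prob_space M using M by (simp add: borel_probs_iff)
  interpret N: prob_space N using N by (simp add: borel_probs_iff)
  interpret pair_sigma_finite M N ..
  have [measurable]: "c \<in> borel_measurable (M \<Otimes>\<^sub>M N)" using M N by (rule c_measurable_prod)
  have "(\<integral>\<^sup>+b. (\<integral>\<^sup>+a. ennreal (- c (a, b)) \<partial>M) \<partial>N) = (\<integral>\<^sup>+a. (\<integral>\<^sup>+b. ennreal (- c (a, b)) \<partial>N) \<partial>M)"
    "(\<integral>\<^sup>+b. (\<integral>\<^sup>+a. ennreal (c (a, b)) \<partial>M) \<partial>N) = (\<integral>\<^sup>+a. (\<integral>\<^sup>+b. ennreal (c (a, b)) \<partial>N) \<partial>M)"
    by (rule Fubini', measurable)+
  then show "payoff_pos dual N M = - payoff_neg c M N" "payoff_neg dual N M = - payoff_pos c M N"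
    by (simp_all add: payoff_pos_def payoff_neg_def dual_def ennreal_max_0 ennreal_minus_min_0)
qed

lemma payoff_defined_dual:
  assumes "M \<in> borel_probs A" "N \<in> borel_probs B"
  shows "payoff_defined dual N M \<longleftrightarrow> payoff_defined c M N"
  unfolding payoff_defined_def payoff_dual_parts[OF assms]
  by (cases "payoff_pos c M N"; cases "payoff_neg c M N") auto

text \<open>For an undefined payoff both sides would be affected by the convention \<open>\<infinity> - \<infinity> = \<infinity>\<close> of \<^typ>\<open>ereal\<close>,
and the equation would fail.\<close>
lemma payoff_dual:
  assumes "M \<in> borel_probs A" "N \<in> borel_probs B" "payoff_defined c M N"
  shows "payoff dual N M = - payoff c M N"
proof -
  have "0 \<le> payoff_pos c M N" "payoff_neg c M N \<le> 0"
    by (simp_all add: payoff_pos_def payoff_neg_def)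
  then show ?thesis
    using assms(3) unfolding payoff_def payoff_defined_def payoff_dual_parts[OF assms(1,2)]
    by (cases "payoff_pos c M N"; cases "payoff_neg c M N") auto
qed

lemma payoff_defined_dirac_II:
  assumes M: "M \<in> borel_probs A" and b: "b \<in> B"
  shows "payoff_defined c M (dirac_on B b)"
proof -
  interpret M: prob_space M using M by (simp add: borel_probs_iff)
  obtain k where k: "\<And>a. a \<in> A \<Longrightarrow> k \<le> c (a, b)"
    using bdd_below_c[OF b] by (auto simp: bdd_below_def)
  have "(\<integral>\<^sup>+a. (\<integral>\<^sup>+y. ennreal (- c (a, y)) \<partial>dirac_on B b) \<partial>M) = (\<integral>\<^sup>+a. ennreal (- c (a, b)) \<partial>M)"
    using b c_measurable_II borel_probs_space[OF M] by (auto intro!: nn_integral_cong simp: nn_integral_dirac_on)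
  also have "\<dots> \<le> (\<integral>\<^sup>+a. ennreal (- k) \<partial>M)"
    using k borel_probs_space[OF M] by (intro nn_integral_mono ennreal_leI) auto
  finally have "(\<integral>\<^sup>+a. (\<integral>\<^sup>+y. ennreal (- c (a, y)) \<partial>dirac_on B b) \<partial>M) \<le> ennreal (- k)"
    by (simp add: M.emeasure_space_1)
  then show ?thesis
    by (cases "\<integral>\<^sup>+a. (\<integral>\<^sup>+y. ennreal (- c (a, y)) \<partial>dirac_on B b) \<partial>M")
       (auto simp: payoff_defined_def payoff_neg_def ennreal_minus_min_0 top_unique)
qed

lemma sensible_dual: "sensible_I B A dual = sensible_II A B c" "sensible_II B A dual = sensible_I A B c"
  unfolding sensible_I_def sensible_II_def using payoff_defined_dual by auto

lemma payoff_flat_dual: "M \<in> borel_probs A \<Longrightarrow> payoff_flat B dual M = - payoff_sharp B c M"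
  unfolding payoff_flat_def payoff_sharp_def
  by (subst ereal_INF_uminus_eq[symmetric])
     (intro INF_cong refl payoff_dual dirac_on_borel_probs payoff_defined_dirac_II)

lemma dual_zsgame: "zsgame B A dual"
  by standard (rule dual_game)

lemma dual_dual: "zsgame.dual dual = c"
  by (auto simp: fun_eq_iff zsgame.dual_def[OF dual_zsgame] dual_def)

lemma payoff_sharp_dual: "N \<in> borel_probs B \<Longrightarrow> payoff_sharp A dual N = - payoff_flat A c N"
  using zsgame.payoff_flat_dual[OF dual_zsgame, of N] unfolding dual_dual by simp

lemma value_dual: "value_sharp B A dual = - value_flat A B c" "value_flat B A dual = - value_sharp A B c"
proof -
  have "value_sharp B A dual = (INF N\<in>sensible_II A B c. - payoff_flat A c N)"
    unfolding value_sharp_def sensible_dual by (intro INF_cong refl payoff_sharp_dual) (simp add: sensible_II_def)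
  then show "value_sharp B A dual = - value_flat A B c" by (simp add: value_flat_def ereal_INF_uminus_eq)
  have "value_flat B A dual = (SUP M\<in>sensible_I A B c. - payoff_sharp B c M)"
    unfolding value_flat_def sensible_dual by (intro SUP_cong refl payoff_flat_dual) (simp add: sensible_I_def)
  then show "value_flat B A dual = - value_sharp A B c" by (simp add: value_sharp_def ereal_SUP_uminus_eq)
qed

lemma sublevel_dual: "sublevel_sharp B A dual (ereal (- v)) = superlevel_flat A B c (ereal v)"
  unfolding sublevel_sharp_def superlevel_flat_def using payoff_sharp_dual
  by (auto simp: ereal_uminus_le_reorder simp flip: uminus_ereal.simps)

lemma payoff_le_payoff_sharp:
  assumes "M \<in> borel_probs A" "N \<in> borel_probs B" "payoff_defined c M N"
  shows "payoff c M N \<le> payoff_sharp B c M"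
  using zsgame.payoff_flat_le_payoff[OF dual_zsgame assms(2,1)] assms
  by (simp add: payoff_defined_dual payoff_dual payoff_flat_dual)

lemma value_flat_le_sharp: "value_flat A B c \<le> value_sharp A B c"
  unfolding value_flat_def value_sharp_def
proof (intro SUP_least INF_greatest)
  fix N M assume "N \<in> sensible_II A B c" "M \<in> sensible_I A B c"
  then have "M \<in> borel_probs A" "N \<in> borel_probs B" "payoff_defined c M N"
    by (auto simp: sensible_I_def sensible_II_def)
  then show "payoff_flat A c N \<le> payoff_sharp B c M"
    using payoff_flat_le_payoff payoff_le_payoff_sharp order_trans by blast
qed

end

context zsgame
begin

lemma dirac_II_sensible: "b \<in> B \<Longrightarrow> dirac_on B b \<in> sensible_II A B c"
  by (simp add: sensible_II_def dirac_on_borel_probs payoff_defined_dirac_II)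

lemma value_flat_gt_minus_infinity: "- \<infinity> < value_flat A B c"
proof -
  obtain b where b: "b \<in> B" using B_ne by blast
  obtain k where k: "\<And>a. a \<in> A \<Longrightarrow> k \<le> c (a, b)"
    using bdd_below_c[OF b] by (auto simp: bdd_below_def)
  have "ereal k \<le> payoff_flat A c (dirac_on B b)"
    unfolding payoff_flat_eq[OF dirac_on_borel_probs[OF b]]
    using b k c_measurable_II by (intro INF_greatest) (simp add: ext_integral_dirac_on)
  also have "\<dots> \<le> value_flat A B c"
    unfolding value_flat_def by (rule SUP_upper[OF dirac_II_sensible[OF b]])
  finally show ?thesis by (cases "value_flat A B c") auto
qed

lemma value_sharp_less_infinity: "value_sharp A B c < \<infinity>"
  using zsgame.value_flat_gt_minus_infinity[OF dual_zsgame] by (simp add: value_dual ereal_less_uminus_reorder)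

text \<open>For a pair of optimal strategies the guarantees squeeze the payoff to exactly \<open>v\<close>. Conversely, testing a
solution against points bounds \<open>payoff_sharp\<close> by \<open>payoff_flat\<close>, while the values force the opposite
inequality.\<close>
lemma is_solution_iff:
  assumes v: "has_value A B c v" and M: "M \<in> sensible_I A B c" and N: "N \<in> sensible_II A B c"
  shows "is_solution A B c M N \<longleftrightarrow> M \<in> sublevel_sharp A B c v \<and> N \<in> superlevel_flat A B c v"
proof -
  have M': "M \<in> borel_probs A" and N': "N \<in> borel_probs B"
    using M N by (auto simp: sensible_I_def sensible_II_def)
  have le: "payoff c M N' \<le> payoff_sharp B c M" if "N' \<in> borel_probs B" for N'
    using payoff_le_payoff_sharp[OF M' that] M that by (simp add: sensible_I_def)
  have ge: "payoff_flat A c N \<le> payoff c M' N" if "M' \<in> borel_probs A" for M'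
    using payoff_flat_le_payoff[OF that N'] N that by (simp add: sensible_II_def)
  show ?thesis
  proof
    assume sol: "is_solution A B c M N"
    have "payoff_sharp B c M \<le> payoff c M N"
      unfolding payoff_sharp_def
    proof (rule SUP_least)
      fix b assume "b \<in> B"
      then show "payoff c M (dirac_on B b) \<le> payoff c M N"
        using sol M' dirac_on_borel_probs unfolding is_solution_def by blast
    qed
    also have "\<dots> \<le> payoff_flat A c N"
      unfolding payoff_flat_def
    proof (rule INF_greatest)
      fix a assume "a \<in> A"
      then show "payoff c M N \<le> payoff c (dirac_on A a) N"
        using sol N' dirac_on_borel_probs unfolding is_solution_def by blast
    qed
    finally have "payoff_sharp B c M \<le> payoff_flat A c N" .
    moreover have "payoff_flat A c N \<le> v"
      using v SUP_upper[OF N, of "payoff_flat A c"] unfolding has_value_def value_flat_def by simp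
    moreover have "v \<le> payoff_sharp B c M"
      using v INF_lower[OF M, of "payoff_sharp B c"] unfolding has_value_def value_sharp_def by simp
    ultimately show "M \<in> sublevel_sharp A B c v \<and> N \<in> superlevel_flat A B c v"
      using M' N' by (auto simp: sublevel_sharp_def superlevel_flat_def)
  next
    assume "M \<in> sublevel_sharp A B c v \<and> N \<in> superlevel_flat A B c v"
    then have v: "payoff_sharp B c M \<le> v" "v \<le> payoff_flat A c N"
      by (auto simp: sublevel_sharp_def superlevel_flat_def)
    have "payoff c M N' \<le> v" if "N' \<in> borel_probs B" for N' using le[OF that] v(1) by (rule order_trans)
    moreover have "v \<le> payoff c M' N" if "M' \<in> borel_probs A" for M' using v(2) ge[OF that] by (rule order_trans)
    ultimately show "is_solution A B c M N"
      using M N M' N' unfolding is_solution_def by (meson order_trans)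
  qed
qed

end

section \<open>Games that are inf-compact for the minimizing player\<close>

locale inf_compact_zsgame = zsgame +
  assumes lsc: "\<And>b. b \<in> B \<Longrightarrow> lsc_on A (\<lambda>a. ereal (c (a, b)))"
    and inf_compact: "\<exists>b0\<in>B. inf_compact_on A (\<lambda>a. ereal (c (a, b0)))"
begin

text \<open>The mixed strategies that Player II cannot bring above \<open>r\<close> by playing \<open>b\<close>.\<close>
definition cut :: "'b \<Rightarrow> real \<Rightarrow> 'a measure set" where
  "cut b r = {M \<in> borel_probs A. ext_integral M (\<lambda>a. c (a, b)) \<le> ereal r}"

lemma closedin_cut: "b \<in> B \<Longrightarrow> closedin (weak_topology A) (cut b r)"
  unfolding cut_def
  by (intro closedin_ext_integral_sublevel lsc c_measurable_I bdd_below_c)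

lemma compactin_cut: "\<exists>b0\<in>B. \<forall>r. compactin (weak_topology A) (cut b0 r)"
proof -
  obtain b0 where "b0 \<in> B" "inf_compact_on A (\<lambda>a. ereal (c (a, b0)))" using inf_compact by blast
  then show ?thesis
    unfolding cut_def
    by (intro bexI[of _ b0] allI compactin_ext_integral_sublevel lsc c_measurable_I bdd_below_c)
qed

lemma sublevel_sharp_eq_cuts: "sublevel_sharp A B c (ereal r) = (\<Inter>b\<in>B. cut b r)"
proof -
  have "(\<Inter>b\<in>B. cut b r) \<subseteq> borel_probs A" using B_ne by (auto simp: cut_def)
  then show ?thesis by (auto simp: sublevel_sharp_def cut_def payoff_sharp_eq SUP_le_iff)
qed

lemma compactin_sublevel_sharp: "compactin (weak_topology A) (sublevel_sharp A B c (ereal r))"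
proof -
  obtain b0 where b0: "b0 \<in> B" "compactin (weak_topology A) (cut b0 r)" using compactin_cut by blast
  have "closedin (weak_topology A) (\<Inter>b\<in>B. cut b r)"
    using B_ne closedin_cut by (intro closedin_Inter) auto
  then show ?thesis
    unfolding sublevel_sharp_eq_cuts using b0 by (intro closed_compactin[OF b0(2)]) auto
qed

text \<open>Integrals are affine in the measure. After the shift to nonnegative integrands this can be
computed in \<^typ>\<open>ennreal\<close>, whether or not \<open>c(\<cdot>, b)\<close> is integrable.\<close>
lemma convex_sublevel_sharp: "convex_measures (sublevel_sharp A B c (ereal r))"
  unfolding convex_measures_def
proof (intro ballI)
  fix M N and t :: real
  assume M: "M \<in> sublevel_sharp A B c (ereal r)" and N: "N \<in> sublevel_sharp A B c (ereal r)" and t: "t \<in> {0..1}"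
  have prob: "M \<in> borel_probs A" "N \<in> borel_probs A" using M N by (auto simp: sublevel_sharp_def)
  then have mix: "mixture t M N \<in> borel_probs A" using t by (rule mixture_borel_probs)
  have "mixture t M N \<in> cut b r" if b: "b \<in> B" for b
  proof -
    obtain k where k: "\<And>a. a \<in> A \<Longrightarrow> k \<le> c (a, b)"
      using bdd_below_c[OF b] by (auto simp: bdd_below_def)
    define m where "m = \<bar>k\<bar> + \<bar>r\<bar>"
    have m: "m \<ge> 0" "0 \<le> r + m" "\<And>a. a \<in> A \<Longrightarrow> - m \<le> c (a, b)" using k unfolding m_def by fastforce+
    have iff: "ext_integral K (\<lambda>a. c (a, b)) \<le> ereal r \<longleftrightarrow> (\<integral>\<^sup>+a. ennreal (c (a, b) + m) \<partial>K) \<le> ennreal (r + m)"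
      if "K \<in> borel_probs A" for K
      using that m borel_probs_space[OF that] c_measurable_I[OF b] borel_probs_measurable[OF that, of "\<lambda>a. c (a, b)" borel]
      by (intro ext_integral_le_iff_nn) (auto simp: borel_probs_iff)
    have le: "(\<integral>\<^sup>+a. ennreal (c (a, b) + m) \<partial>M) \<le> ennreal (r + m)" "(\<integral>\<^sup>+a. ennreal (c (a, b) + m) \<partial>N) \<le> ennreal (r + m)"
      using M N b prob iff unfolding sublevel_sharp_eq_cuts cut_def by auto
    have meas: "(\<lambda>a. c (a, b)) \<in> borel_measurable M"
      using c_measurable_I[OF b] by (simp add: borel_probs_measurable[OF prob(1)])
    have "(\<integral>\<^sup>+a. ennreal (c (a, b) + m) \<partial>mixture t M N)
        = ennreal t * (\<integral>\<^sup>+a. ennreal (c (a, b) + m) \<partial>M) + ennreal (1 - t) * (\<integral>\<^sup>+a. ennreal (c (a, b) + m) \<partial>N)"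
      using prob meas by (intro nn_integral_mixture) (auto simp: borel_probs_iff)
    also have "\<dots> \<le> ennreal t * ennreal (r + m) + ennreal (1 - t) * ennreal (r + m)"
      by (intro add_mono mult_left_mono le) auto
    also have "\<dots> = ennreal (t * (r + m) + (1 - t) * (r + m))"
      using t m by (simp add: ennreal_mult ennreal_plus)
    also have "t * (r + m) + (1 - t) * (r + m) = r + m" by (simp add: algebra_simps)
    finally show ?thesis using iff[OF mix] mix unfolding cut_def by simp
  qed
  then show "mixture t M N \<in> sublevel_sharp A B c (ereal r)" unfolding sublevel_sharp_eq_cuts by blast
qed

text \<open>Compactness of one cut at the slightly larger level \<open>r + 1\<close> allows finitely many cuts to be
selected together with a gap \<open>\<epsilon>\<close>: the covering uses the complements of the cuts at all levels
\<open>r + 1 / (n + 1)\<close>. A gap is needed later for strictness.\<close>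
lemma finitely_many_cuts:
  assumes empty: "sublevel_sharp A B c (ereal r) = {}"
  obtains I \<epsilon> where "finite I" "I \<noteq> {}" "I \<subseteq> B" "\<epsilon> > 0" "(\<Inter>b\<in>I. cut b (r + \<epsilon>)) = {}"
proof -
  obtain b0 where b0: "b0 \<in> B" "compactin (weak_topology A) (cut b0 (r + 1))" using compactin_cut by blast
  define V where "V p = borel_probs A - cut (fst p) (r + 1 / real (Suc (snd p)))" for p :: "'b \<times> nat"
  have cut_mono: "cut b s \<subseteq> cut b s'" if "s \<le> s'" for b s s'
    using that by (auto simp: cut_def intro: order_trans)
  have "openin (weak_topology A) (V p)" if "p \<in> B \<times> UNIV" for p
    using closedin_cut[of "fst p"] that unfolding V_def closedin_def topspace_weak_topology by auto
  then have op: "\<forall>U\<in>V ` (B \<times> UNIV). openin (weak_topology A) U" by blast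
  have "cut b0 (r + 1) \<subseteq> \<Union> (V ` (B \<times> UNIV))"
  proof
    fix M assume "M \<in> cut b0 (r + 1)"
    then have M: "M \<in> borel_probs A" by (simp add: cut_def)
    moreover have "M \<notin> (\<Inter>b\<in>B. cut b r)" using empty unfolding sublevel_sharp_eq_cuts by blast
    ultimately obtain b where b: "b \<in> B" "ereal r < ext_integral M (\<lambda>a. c (a, b))"
      by (auto simp: cut_def not_le)
    then obtain s where s: "r < s" "ereal s < ext_integral M (\<lambda>a. c (a, b))"
      using ereal_dense2[OF b(2)] by auto
    obtain n where "1 / real (Suc n) < s - r" using s(1) nat_approx_posE[of "s - r"] by auto
    then have "M \<notin> cut b (r + 1 / real (Suc n))"
      using s(2) by (auto simp: cut_def not_le intro: le_less_trans[of _ "ereal s"])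
    then have "M \<in> V (b, n)" using M by (simp add: V_def)
    then show "M \<in> \<Union> (V ` (B \<times> UNIV))" using b(1) by blast
  qed
  then obtain \<F> where "finite \<F>" "\<F> \<subseteq> V ` (B \<times> UNIV)" "cut b0 (r + 1) \<subseteq> \<Union>\<F>"
    using b0(2) op unfolding compactin_def by meson
  then obtain D where D: "D \<subseteq> B \<times> UNIV" "finite D" "cut b0 (r + 1) \<subseteq> \<Union> (V ` D)"
    by (metis finite_subset_image)
  define n where "n = Max (insert 0 (snd ` D))"
  define \<epsilon> where "\<epsilon> = 1 / real (Suc n)"
  have \<epsilon>: "0 < \<epsilon>" "\<epsilon> \<le> 1" by (auto simp: \<epsilon>_def)
  have \<epsilon>_le: "\<epsilon> \<le> 1 / real (Suc (snd p))" if "p \<in> D" for p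
  proof -
    have "snd p \<le> n" unfolding n_def using D(2) that by (intro Max_ge) auto
    then show ?thesis unfolding \<epsilon>_def by (intro divide_left_mono) auto
  qed
  show thesis
  proof (rule that[of "insert b0 (fst ` D)" \<epsilon>])
    show "(\<Inter>b\<in>insert b0 (fst ` D). cut b (r + \<epsilon>)) = {}"
    proof (rule ccontr)
      assume "(\<Inter>b\<in>insert b0 (fst ` D). cut b (r + \<epsilon>)) \<noteq> {}"
      then obtain M where M: "M \<in> cut b0 (r + \<epsilon>)" "\<And>p. p \<in> D \<Longrightarrow> M \<in> cut (fst p) (r + \<epsilon>)" by blast
      then have "M \<in> cut b0 (r + 1)" using cut_mono[of "r + \<epsilon>" "r + 1"] \<epsilon> by auto
      then obtain p where p: "p \<in> D" "M \<in> V p" using D(3) by blast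
      then have "M \<in> cut (fst p) (r + 1 / real (Suc (snd p)))"
        using M(2)[OF p(1)] cut_mono[of "r + \<epsilon>"] \<epsilon>_le[OF p(1)] by (meson add_left_mono subsetD)
      then show False using p(2) by (simp add: V_def)
    qed
  qed (use D b0 \<epsilon> in auto)
qed

text \<open>The alternative is applied to the mixed strategies for which the finitely many payoffs are real.
They form a convex family, and since they include the Dirac measures, the weights obtained bound the
payoff from below at every point of \<open>A\<close>. A finitely supported strategy is sensible because a finite
combination of the functions \<open>c(\<cdot>, b)\<close> is bounded below.\<close>
lemma finitely_supported_improvement:
  assumes I: "finite I" "I \<noteq> {}" "I \<subseteq> B" and empty: "(\<Inter>b\<in>I. cut b s) = {}"
  shows "\<exists>N\<in>sensible_II A B c. ereal s \<le> payoff_flat A c N"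
proof -
  define P where "P = {M \<in> borel_probs A. \<forall>b\<in>I. integrable M (\<lambda>a. c (a, b))}"
  define f where "f M b = (\<integral>a. c (a, b) \<partial>M) - s" for M :: "'a measure" and b
  have "\<exists>w. (\<forall>b\<in>I. 0 \<le> w b) \<and> sum w I = 1 \<and> (\<forall>M\<in>P. 0 \<le> (\<Sum>b\<in>I. w b * f M b))"
  proof (rule convexlike_alternative[OF I(1,2)])
    fix M N and t :: real assume MN: "M \<in> P" "N \<in> P" and t: "t \<in> {0..1}"
    have sets: "sets N = sets M" using MN by (simp add: P_def borel_probs_iff)
    have "mixture t M N \<in> P"
      using MN t unfolding P_def by (auto intro: mixture_borel_probs integral_mixture(1)[OF sets])
    moreover have "f (mixture t M N) b = t * f M b + (1 - t) * f N b" if "b \<in> I" for b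
    proof -
      have "(\<integral>a. c (a, b) \<partial>mixture t M N) = t * (\<integral>a. c (a, b) \<partial>M) + (1 - t) * (\<integral>a. c (a, b) \<partial>N)"
        using MN that t unfolding P_def by (intro integral_mixture(2)[OF sets]) auto
      then show ?thesis unfolding f_def by (simp add: algebra_simps)
    qed
    ultimately show "\<exists>K\<in>P. \<forall>b\<in>I. f K b \<le> t * f M b + (1 - t) * f N b" by (metis order_refl)
  next
    fix M assume M: "M \<in> P"
    then obtain b where b: "b \<in> I" "M \<notin> cut b s" using empty by blast
    then have "ereal s < ereal (\<integral>a. c (a, b) \<partial>M)"
      using M ext_integral_eq_integral[of M "\<lambda>a. c (a, b)"] unfolding P_def cut_def by auto
    then show "\<exists>b\<in>I. 0 \<le> f M b" using b(1) by (intro bexI[of _ b]) (auto simp: f_def)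
  qed
  then obtain w where w: "\<And>b. b \<in> I \<Longrightarrow> 0 \<le> w b" "sum w I = 1" "\<And>M. M \<in> P \<Longrightarrow> 0 \<le> (\<Sum>b\<in>I. w b * f M b)"
    by blast
  obtain N where N: "N \<in> borel_probs B" and N_int: "\<And>h. h \<in> borel_measurable (restrict_space borel B) \<Longrightarrow>
      (\<integral>\<^sup>+b. h b \<partial>N) = (\<Sum>b\<in>I. ennreal (w b) * h b)"
    using finitely_supported_strategy[OF I(1,3) w(1,2)] by blast
  have N_real: "(\<integral>\<^sup>+b. ennreal (h b) \<partial>N) = ennreal (\<Sum>b\<in>I. w b * max (h b) 0)"
    if [measurable]: "h \<in> borel_measurable (restrict_space borel B)" for h
  proof -
    have "(\<integral>\<^sup>+b. ennreal (h b) \<partial>N) = (\<Sum>b\<in>I. ennreal (w b) * ennreal (h b))" by (rule N_int) measurable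
    also have "\<dots> = (\<Sum>b\<in>I. ennreal (w b * max (h b) 0))"
      using w(1) by (intro sum.cong refl) (simp add: ennreal_mult ennreal_max_0)
    finally show ?thesis using w(1) by (simp add: sum_ennreal)
  qed
  have N_ext: "ext_integral N h = ereal (\<Sum>b\<in>I. w b * h b)"
    if [measurable]: "h \<in> borel_measurable (restrict_space borel B)" for h
  proof -
    have "ext_integral N h = ereal ((\<Sum>b\<in>I. w b * max (h b) 0) - (\<Sum>b\<in>I. w b * max (- h b) 0))"
      using w(1) unfolding ext_integral_def by (simp add: N_real sum_nonneg)
    also have "(\<Sum>b\<in>I. w b * max (h b) 0) - (\<Sum>b\<in>I. w b * max (- h b) 0) = (\<Sum>b\<in>I. w b * h b)"
      unfolding sum_subtractf[symmetric] by (intro sum.cong refl) (auto simp: max_def)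
    finally show ?thesis .
  qed
  have "N \<in> sensible_II A B c"
    unfolding sensible_II_def
  proof (intro CollectI conjI ballI N)
    fix M assume M: "M \<in> borel_probs A"
    interpret M: prob_space M using M by (simp add: borel_probs_iff)
    have "\<forall>b\<in>I. \<exists>k. \<forall>a\<in>A. k \<le> c (a, b)" using bdd_below_c I(3) by (auto simp: bdd_below_def)
    then obtain k where k: "\<And>a b. b \<in> I \<Longrightarrow> a \<in> A \<Longrightarrow> k b \<le> c (a, b)" by metis
    define K where "K = (\<Sum>b\<in>I. w b * max (- k b) 0)"
    have "(\<integral>\<^sup>+a. (\<integral>\<^sup>+b. ennreal (- c (a, b)) \<partial>N) \<partial>M) \<le> (\<integral>\<^sup>+a. ennreal K \<partial>M)"
    proof (rule nn_integral_mono)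
      fix a assume "a \<in> space M"
      then have a: "a \<in> A" using borel_probs_space[OF M] by simp
      have "(\<integral>\<^sup>+b. ennreal (- c (a, b)) \<partial>N) = ennreal (\<Sum>b\<in>I. w b * max (- c (a, b)) 0)"
        using c_measurable_II[OF a] by (intro N_real) simp
      also have "\<dots> \<le> ennreal K"
        unfolding K_def using w(1) k a by (intro ennreal_leI sum_mono mult_left_mono) fastforce+
      finally show "(\<integral>\<^sup>+b. ennreal (- c (a, b)) \<partial>N) \<le> ennreal K" .
    qed
    then have "(\<integral>\<^sup>+a. (\<integral>\<^sup>+b. ennreal (- c (a, b)) \<partial>N) \<partial>M) \<le> ennreal K" by (simp add: M.emeasure_space_1)
    then show "payoff_defined c M N"
      by (cases "\<integral>\<^sup>+a. (\<integral>\<^sup>+b. ennreal (- c (a, b)) \<partial>N) \<partial>M")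
         (auto simp: payoff_defined_def payoff_neg_def ennreal_minus_min_0 top_unique)
  qed
  moreover have "ereal s \<le> payoff_flat A c N"
    unfolding payoff_flat_eq[OF N]
  proof (rule INF_greatest)
    fix a assume a: "a \<in> A"
    have prob: "dirac_on A a \<in> borel_probs A" by (rule dirac_on_borel_probs[OF a])
    have int: "integrable (dirac_on A a) (\<lambda>x. c (x, b))" "(\<integral>x. c (x, b) \<partial>dirac_on A a) = c (a, b)" if "b \<in> I" for b
    proof -
      have meas: "(\<lambda>x. c (x, b)) \<in> borel_measurable (restrict_space borel A)"
        using that I(3) by (intro c_measurable_I) auto
      then have "(\<lambda>x. ennreal (c (x, b))) \<in> borel_measurable (restrict_space borel A)"
         "(\<lambda>x. ennreal (- c (x, b))) \<in> borel_measurable (restrict_space borel A)" by measurable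
      then show int: "integrable (dirac_on A a) (\<lambda>x. c (x, b))"
        unfolding real_integrable_def borel_probs_measurable[OF prob]
        using meas a by (simp add: nn_integral_dirac_on)
      show "(\<integral>x. c (x, b) \<partial>dirac_on A a) = c (a, b)"
        using ext_integral_eq_integral[OF int] ext_integral_dirac_on[OF a meas] by simp
    qed
    then have "dirac_on A a \<in> P" using prob by (simp add: P_def)
    from w(3)[OF this] have "0 \<le> (\<Sum>b\<in>I. w b * (c (a, b) - s))" using int by (simp add: f_def)
    also have "\<dots> = (\<Sum>b\<in>I. w b * c (a, b)) - s"
      using w(2) by (simp add: right_diff_distrib sum_subtractf sum_distrib_right[symmetric])
    finally show "ereal s \<le> ext_integral N (\<lambda>b. c (a, b))"
      using N_ext[OF c_measurable_II[OF a]] by simp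
  qed
  ultimately show ?thesis by blast
qed

text \<open>The minimax theorem together with attainment of the minimum: otherwise Player II could guarantee
\<open>r + \<epsilon>\<close>, more than \<open>value_flat\<close>.\<close>
lemma sublevel_sharp_nonempty:
  assumes "value_flat A B c \<le> ereal r"
  shows "sublevel_sharp A B c (ereal r) \<noteq> {}"
proof
  assume "sublevel_sharp A B c (ereal r) = {}"
  then obtain I \<epsilon> where I: "finite I" "I \<noteq> {}" "I \<subseteq> B" "\<epsilon> > 0" "(\<Inter>b\<in>I. cut b (r + \<epsilon>)) = {}"
    by (rule finitely_many_cuts)
  then obtain N where N: "N \<in> sensible_II A B c" "ereal (r + \<epsilon>) \<le> payoff_flat A c N"
    using finitely_supported_improvement by blast
  note N(2)
  also have "payoff_flat A c N \<le> value_flat A B c" unfolding value_flat_def by (rule SUP_upper[OF N(1)])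
  finally have "ereal (r + \<epsilon>) \<le> ereal r" using assms by (rule order_trans)
  then show False using I(4) by simp
qed

end

section \<open>Value and solutions\<close>

theorem theorem3p9:
  fixes A :: "'a::polish_space set" and B :: "'b::polish_space set"
    and c :: "'a \<times> 'b \<Rightarrow> real"
  assumes game: "zero_sum_game A B c"
    and a1: "\<And>b. b \<in> B \<Longrightarrow> lsc_on A (\<lambda>a. ereal (c (a, b)))"
    and a2: "\<exists>b0\<in>B. inf_compact_on A (\<lambda>a. ereal (c (a, b0)))"
    and b1: "\<And>a. a \<in> A \<Longrightarrow> usc_on B (\<lambda>b. ereal (c (a, b)))"
    and b2: "\<exists>a0\<in>A. sup_compact_on B (\<lambda>b. ereal (c (a0, b)))"
    and unsensible_I: "\<And>\<pi>A. \<pi>A \<in> unsensible_I A B c \<Longrightarrow> payoff_sharp B c \<pi>A > value_sharp A B c"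
    and unsensible_II: "\<And>\<pi>B. \<pi>B \<in> unsensible_II A B c \<Longrightarrow> payoff_flat A c \<pi>B < value_flat A B c"
  shows "\<exists>v::real.
     \<comment> \<open>(i)\<close>
     has_value A B c (ereal v) \<and>
     (\<exists>\<pi>A\<in>sublevel_sharp A B c (ereal v). \<exists>\<pi>B\<in>superlevel_flat A B c (ereal v).
        is_solution A B c \<pi>A \<pi>B) \<and>
     \<comment> \<open>(ii)\<close>
     sublevel_sharp A B c (ereal v) \<noteq> {} \<and>
     convex_measures (sublevel_sharp A B c (ereal v)) \<and>
     compactin (weak_topology A) (sublevel_sharp A B c (ereal v)) \<and>
     superlevel_flat A B c (ereal v) \<noteq> {} \<and>
     convex_measures (superlevel_flat A B c (ereal v)) \<and>
     compactin (weak_topology B) (superlevel_flat A B c (ereal v)) \<and>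
     sublevel_sharp A B c (ereal v) \<subseteq> sensible_I A B c \<and>
     superlevel_flat A B c (ereal v) \<subseteq> sensible_II A B c \<and>
     \<comment> \<open>(iii)\<close>
     (\<forall>\<pi>A\<in>sensible_I A B c. \<forall>\<pi>B\<in>sensible_II A B c.
        is_solution A B c \<pi>A \<pi>B \<longleftrightarrow>
        \<pi>A \<in> sublevel_sharp A B c (ereal v) \<and> \<pi>B \<in> superlevel_flat A B c (ereal v))"
proof -
  interpret I: inf_compact_zsgame A B c
    by unfold_locales (use game a1 a2 in auto)
  have dual: "ereal (I.dual (b, a)) = - ereal (c (a, b))" for a b by (simp add: I.dual_def)
  interpret II: inf_compact_zsgame B A I.dual
  proof
    show "zero_sum_game B A I.dual" by (rule I.dual_game)
    show "lsc_on B (\<lambda>b. ereal (I.dual (b, a)))" if "a \<in> A" for a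
      using b1[OF that] unfolding lsc_on_def usc_on_def dual ereal_Liminf_uminus ereal_minus_le_minus .
    show "\<exists>a0\<in>A. inf_compact_on B (\<lambda>b. ereal (I.dual (b, a0)))"
      using b2 unfolding sup_compact_on_def dual .
  qed
  have weak: "value_flat A B c \<le> value_sharp A B c" by (rule I.value_flat_le_sharp)
  obtain v where v: "value_flat A B c = ereal v"
    using I.value_flat_gt_minus_infinity I.value_sharp_less_infinity weak
    by (cases "value_flat A B c") auto
  obtain M where M: "M \<in> sublevel_sharp A B c (ereal v)"
    using I.sublevel_sharp_nonempty[of v] v by auto
  have sharp_ge: "value_sharp A B c \<le> payoff_sharp B c K" if "K \<in> borel_probs A" for K
  proof (cases "K \<in> sensible_I A B c")
    case True
    then show ?thesis unfolding value_sharp_def by (rule INF_lower)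
  next
    case False
    then show ?thesis using unsensible_I[of K] that by (simp add: unsensible_I_def)
  qed
  have "value_sharp A B c \<le> ereal v"
    using M sharp_ge[of M] by (auto simp: sublevel_sharp_def intro: order_trans)
  then have sharp: "value_sharp A B c = ereal v" using weak v by simp
  have has_value: "has_value A B c (ereal v)" by (simp add: has_value_def v sharp)
  have "superlevel_flat A B c (ereal v) \<noteq> {}"
    using II.sublevel_sharp_nonempty[of "- v"] unfolding I.sublevel_dual by (simp add: I.value_dual sharp)
  then obtain N where N: "N \<in> superlevel_flat A B c (ereal v)" by blast
  have sub: "sublevel_sharp A B c (ereal v) \<subseteq> sensible_I A B c"
    using unsensible_I sharp unfolding sublevel_sharp_def unsensible_I_def by force
  have super: "superlevel_flat A B c (ereal v) \<subseteq> sensible_II A B c"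
    using unsensible_II v unfolding superlevel_flat_def unsensible_II_def by force
  have iff: "\<forall>\<pi>A\<in>sensible_I A B c. \<forall>\<pi>B\<in>sensible_II A B c.
        is_solution A B c \<pi>A \<pi>B \<longleftrightarrow>
        \<pi>A \<in> sublevel_sharp A B c (ereal v) \<and> \<pi>B \<in> superlevel_flat A B c (ereal v)"
    using I.is_solution_iff[OF has_value] by blast
  have "is_solution A B c M N" using iff M N sub super by blast
  then show ?thesis
    using has_value M N sub super iff I.convex_sublevel_sharp[of v] I.compactin_sublevel_sharp[of v]
      II.convex_sublevel_sharp[of "- v"] II.compactin_sublevel_sharp[of "- v"]
    unfolding I.sublevel_dual by blast
qed

end
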